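(* Suppose that $\Theta\subseteq\mathbb{R}^d$ is a compact convex set with $0\in\Theta$, that $\mathcal{M}$ is the set of all left-stochastic $(m+1)\times(m+1)$ matrices and $\Lambda:=\Delta^{m+1}$, and that the objective and proxy constraint functions $g_0,\tilde g_1,\dots,\tilde g_m:\Theta\to\mathbb{R}$ are convex (but not necessarily the constraint functions $g_1,\dots,g_m:\Theta\to\mathbb{R}$), with $\tilde g_i\ge g_i$ on $\Theta$ for each $i\in\{1,\dots,m\}$. Define the three upper bounds $B_\Theta\ge\max_{\theta\in\Theta}\|\theta\|_2$, $B_{\check\Delta}\ge\max_{t\in\{1,\dots,T\}}\|\check\Delta_\theta^{(t)}\|_2$ and $B_\Delta\ge\max_{t\in\{1,\dots,T\}}\|\Delta_\lambda^{(t)}\|_\infty$. If we run the stochastic proxy-Lagrangian algorithm (described in the context) with the step sizes $\eta_\theta:=B_\Theta/(B_{\check\Delta}\sqrt{2T})$ and $\eta_\lambda:=\sqrt{(m+1)\ln(m+1)/(TB_\Delta^2)}$, then with probability $1-\delta$ over the draws of the stochastic (sub)gradients, both of the following hold: $$\frac1T\sum_{t=1}^T\mathcal{L}_\theta(\theta^{(t)},\lambda^{(t)})-\inf_{\theta^*\in\Theta}\frac1T\sum_{t=1}^T\mathcal{L}_\theta(\theta^*,\lambda^{(t)})\le2B_\Theta B_{\check\Delta}\sqrt{\frac{1+16\ln\frac2\delta}{T}},$$ $$\max_{M^*\in\mathcal{M}}\frac1T\sum_{t=1}^T\mathcal{L}_\lambda(\theta^{(t)},M^*\lambda^{(t)}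)-\frac1T\sum_{t=1}^T\mathcal{L}_\lambda(\theta^{(t)},\lambda^{(t)})\le2B_\Delta\sqrt{\frac{2(m+1)\ln(m+1)\left(1+16\ln\frac2\delta\right)}{T}}.$$
   Context: $\Delta^{m+1}:=\{\lambda\in\mathbb{R}_+^{m+1}:\sum_j\lambda_j=1\}$; a square matrix is left-stochastic if each of its columns lies in the simplex. The proxy-Lagrangians are $\mathcal{L}_\theta(\theta,\lambda):=\lambda_1g_0(\theta)+\sum_{i=1}^m\lambda_{i+1}\tilde g_i(\theta)$ and $\mathcal{L}_\lambda(\theta,\lambda):=\sum_{i=1}^m\lambda_{i+1}g_i(\theta)$ for $\theta\in\Theta$, $\lambda\in\Delta^{m+1}$. Stochastic proxy-Lagrangian algorithm: initialize $\theta^{(1)}=0$ and $M^{(1)}\in\mathbb{R}^{(m+1)\times(m+1)}$ with all entries $1/(m+1)$. For $t=1,\dots,T$: - let $\lambda^{(t)}\in\Lambda$ be a stationary distribution of $M^{(t)}$, i.e. $M^{(t)}\lambda^{(t)}=\lambda^{(t)}$; - let $\check\Delta_\theta^{(t)}$ be a stochastic subgradient of $\mathcal{L}_\theta(\theta^{(t)},\lambda^{(t)})$ with respect to $\theta$; - let $\Delta_\lambda^{(t)}$ be a stochastic gradient of $\mathcal{L}_\lambda(\theta^{(t)},\lambda^{(t)})$ with respect to $\lambda$; - $\theta^{(t+1)}=\Pi_\Theta(\theta^{(t)}-\eta_\theta\check\Delta_\theta^{(t)})$, with $\Pi_\Theta$ Euclidean projection onto $\Theta$; - $\tilde M^{(t+1)}_{ij}=M^{(t)}_{ij}\exp\big(\eta_\lambda(\Delta_\lambda^{(t)})_i\lambda^{(t)}_j\big)$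 for all $i,j$; - $M^{(t+1)}_{:,i}=\tilde M^{(t+1)}_{:,i}/\|\tilde M^{(t+1)}_{:,i}\|_1$ for each column $i\in\{1,\dots,m+1\}$. Stochastic (sub)gradients are understood conditionally on the current iterate: with $f_t:=\mathcal{L}_\theta(\cdot,\lambda^{(t)})$, $\mathbb{E}[\check\Delta_\theta^{(t)}\mid\theta^{(t)}]\in\partial f_t(\theta^{(t)})$ (the subdifferential); with $h_t:=\mathcal{L}_\lambda(\theta^{(t)},\cdot)$, $\mathbb{E}[\Delta_\lambda^{(t)}\mid\lambda^{(t)}]=\nabla h_t(\lambda^{(t)})$.
   Formalization: The stochastic (sub)gradients are assumed unbiased conditionally on all iterates up to round t and all draws of earlier rounds, not only on the current iterate; conditioning on the current iterate alone allows noise correlated across rounds, for which the bound fails. *)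

theory Defs
  imports "HOL-Probability.Probability"
begin

text \<open>
  Conventions.  The \<open>m\<close> constraints are indexed by a finite type \<open>'m\<close>, and the \<open>m + 1\<close> coordinates
  of the multiplier \<open>\<lambda>\<close> by \<open>'m option\<close>: \<open>None\<close> is the coordinate of the objective and \<open>Some i\<close> the
  coordinate of the \<open>i\<close>-th constraint.  The functions \<open>g\<^sub>0\<close>, \<open>g\<^sub>i\<close>, \<open>gt\<^sub>i\<close> (the proxies) live on
  \<open>\<Theta>\<close>; their values outside \<open>\<Theta>\<close> are never used.
\<close>

definition simplex_set :: "(real ^ 'n) set" where
  "simplex_set = {l. (\<forall>j. 0 \<le> l $ j) \<and> (\<Sum>j\<in>UNIV. l $ j) = 1}"

definition left_stochastic :: "(real ^ 'n ^ 'n) set" where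
  "left_stochastic = {A. \<forall>j. column j A \<in> simplex_set}"

definition L_theta ::
  "(real ^ 'd \<Rightarrow> real) \<Rightarrow> ('m::finite \<Rightarrow> real ^ 'd \<Rightarrow> real) \<Rightarrow> real ^ 'd \<Rightarrow> real ^ ('m option) \<Rightarrow> real" where
  "L_theta g0 gt \<theta> l = l $ None * g0 \<theta> + (\<Sum>i\<in>UNIV. l $ Some i * gt i \<theta>)"

definition L_lambda ::
  "('m::finite \<Rightarrow> real ^ 'd \<Rightarrow> real) \<Rightarrow> real ^ 'd \<Rightarrow> real ^ ('m option) \<Rightarrow> real" where
  "L_lambda g \<theta> l = (\<Sum>i\<in>UNIV. l $ Some i * g i \<theta>)"

text \<open>Subdifferential at \<open>x\<close> of a function defined on \<open>S\<close> only.\<close>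

definition subdifferential :: "(real ^ 'd) set \<Rightarrow> (real ^ 'd \<Rightarrow> real) \<Rightarrow> real ^ 'd \<Rightarrow> (real ^ 'd) set" where
  "subdifferential S f x = {v. \<forall>y\<in>S. f y \<ge> f x + v \<bullet> (y - x)}"

definition l1_norm :: "real ^ 'n \<Rightarrow> real" where
  "l1_norm x = (\<Sum>j\<in>UNIV. \<bar>x $ j\<bar>)"

definition exp_update :: "real \<Rightarrow> real ^ 'n ^ 'n \<Rightarrow> real ^ 'n \<Rightarrow> real ^ 'n \<Rightarrow> real ^ 'n ^ 'n" where
  "exp_update \<eta> A D l = (\<chi> i j. A $ i $ j * exp (\<eta> * D $ i * l $ j))"

definition normalize_columns :: "real ^ 'n ^ 'n \<Rightarrow> real ^ 'n ^ 'n" where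
  "normalize_columns A = (\<chi> i j. A $ i $ j / l1_norm (column j A))"

text \<open>
  One run of the algorithm, for given draws \<open>D_sub t\<close>, \<open>D_grad t\<close> of the stochastic (sub)gradients in
  the rounds \<open>t = 1, \<dots>, T\<close>.  What makes these draws stochastic (sub)gradients is a condition on
  their conditional expectations, which is not part of this pathwise definition.
\<close>

definition proxy_lagrangian_run ::
  "(real ^ 'd) set \<Rightarrow> real \<Rightarrow> real \<Rightarrow> nat \<Rightarrow> (nat \<Rightarrow> real ^ 'd) \<Rightarrow> (nat \<Rightarrow> real ^ 'n) \<Rightarrow>
    (nat \<Rightarrow> real ^ 'n ^ 'n) \<Rightarrow> (nat \<Rightarrow> real ^ 'd) \<Rightarrow> (nat \<Rightarrow> real ^ 'n) \<Rightarrow> bool" where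
  "proxy_lagrangian_run \<Theta> eta_theta eta_lambda T \<theta> l M D_sub D_grad \<longleftrightarrow>
     \<theta> 1 = 0 \<and> M 1 = (\<chi> i j. 1 / real CARD('n)) \<and>
     (\<forall>t\<in>{1..T}.
        l t \<in> simplex_set \<and> M t *v l t = l t \<and>
        \<theta> (t + 1) = closest_point \<Theta> (\<theta> t - eta_theta *\<^sub>R D_sub t) \<and>
        M (t + 1) = normalize_columns (exp_update eta_lambda (M t) (D_grad t) (l t)))"

text \<open>
  The sigma-algebra of everything known just before the draws of round \<open>t\<close>: the iterates of the
  rounds \<open>1, \<dots>, t\<close> and the draws of the rounds \<open>1, \<dots>, t - 1\<close>.  The conditional mean of a
  stochastic (sub)gradient is taken with respect to it: \<open>f\<^sub>t\<close> and \<open>h\<^sub>t\<close> are themselves random, and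
  conditioning on a single iterate would not rule out noise that is correlated across rounds.
\<close>

definition history ::
  "'w measure \<Rightarrow> (nat \<Rightarrow> 'w \<Rightarrow> real ^ 'd) \<Rightarrow> (nat \<Rightarrow> 'w \<Rightarrow> real ^ 'n) \<Rightarrow>
    (nat \<Rightarrow> 'w \<Rightarrow> real ^ 'd) \<Rightarrow> (nat \<Rightarrow> 'w \<Rightarrow> real ^ 'n) \<Rightarrow> nat \<Rightarrow> 'w measure" where
  "history P \<theta> l D_sub D_grad t = sigma (space P)
     ({\<theta> s -` A \<inter> space P | s A. s \<in> {1..t} \<and> A \<in> sets borel} \<union>
      {l s -` A \<inter> space P | s A. s \<in> {1..t} \<and> A \<in> sets borel} \<union>
      {D_sub s -` A \<inter> space P | s A. s \<in> {1..<t} \<and> A \<in> sets borel} \<union>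
      {D_grad s -` A \<inter> space P | s A. s \<in> {1..<t} \<and> A \<in> sets borel})"

text \<open>Conditional expectation of a random vector, coordinate by coordinate.\<close>

definition vec_cond_exp :: "'w measure \<Rightarrow> 'w measure \<Rightarrow> ('w \<Rightarrow> real ^ 'n) \<Rightarrow> 'w \<Rightarrow> real ^ 'n" where
  "vec_cond_exp P F X \<omega> = (\<chi> i. real_cond_exp P F (\<lambda>\<omega>. X \<omega> $ i) \<omega>)"

text \<open>
  \<open>Q\<close> holds with probability at least \<open>p\<close>.  No measurability of the \<open>g\<^sub>i\<close> is assumed, so
  \<open>{\<omega>. Q \<omega>}\<close> need not be an event; it is required to contain an event of probability at least \<open>p\<close>.
  If it is an event, this is just \<open>measure P {\<omega> \<in> space P. Q \<omega>} \<ge> p\<close>.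
\<close>

definition with_prob_at_least :: "'w measure \<Rightarrow> real \<Rightarrow> ('w \<Rightarrow> bool) \<Rightarrow> bool" where
  "with_prob_at_least P p Q \<longleftrightarrow> (\<exists>E\<in>sets P. measure P E \<ge> p \<and> (\<forall>\<omega>\<in>E. Q \<omega>))"

end

theory Submission
  imports Defs
begin

text \<open>
  Each player runs a no-regret algorithm on its stochastic gradients \<open>D\<^sub>t\<close>: projected gradient
  descent for \<open>\<theta>\<close>, and one multiplicative-weights learner per column of \<open>M\<close> for \<open>\<lambda>\<close>, where
  stationarity \<open>M\<^sub>t \<lambda>\<^sub>t = \<lambda>\<^sub>t\<close> turns the sum of the column regrets into the swap regret.
  It remains to control the noise \<open>N\<^sub>t = G\<^sub>t - D\<^sub>t\<close>, with \<open>G\<^sub>t\<close> the conditional mean, against a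
  comparator chosen in hindsight.  A second, fictitious copy of the algorithm is run on \<open>N\<^sub>t\<close>;
  it pays for the comparator pathwise, and what is left is the pairing of \<open>N\<^sub>t\<close> with the
  difference of two predictable iterates, a martingale difference to which Azuma-Hoeffding applies.
  In Hoeffding's lemma only the range of \<open>D\<^sub>t\<close> counts, not that of \<open>N\<^sub>t\<close>, and for \<open>\<theta>\<close> this factor of
  two is needed to stay below the stated constant when \<open>\<delta>\<close> is close to 1.
\<close>

subsection \<open>The Azuma-Hoeffding inequality\<close>

text \<open>A comparator chosen in hindsight depends on the noise, so its pairing with the noise is
  not a martingale difference. With \<open>y\<^sub>t\<close> the iterates of the fictitious copy,
  the pathwise identity is \<open>G\<^sub>t \<bullet> (\<theta>\<^sub>t - x) = D\<^sub>t \<bullet>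
  (\<theta>\<^sub>t - x) + N\<^sub>t \<bullet> (y\<^sub>t - x) + N\<^sub>t \<bullet>
  (\<theta>\<^sub>t - y\<^sub>t)\<close>. The comparator \<open>x\<close> is absent from the only
  term that needs probability, so one event serves all comparators and no union bound over them
  occurs. For the multipliers the copy is a matrix \<open>R\<^sub>t\<close> for which
  \<open>\<lambda>\<^sub>t\<close> is not stationary; its move is
  \<open>R\<^sub>t \<lambda>\<^sub>t\<close>, and the martingale part pairs the noise with
  \<open>R\<^sub>t \<lambda>\<^sub>t - \<lambda>\<^sub>t\<close>. The copy at time t is computed
  from the noise of the rounds before t. Its predictability is why the history records the earlier
  draws besides the iterates. The range is saved because, given the history, the centre is a
  constant: the increment moves in an interval as short as that of the paired draw, although its
  modulus can be twice as large.\<close>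

lemma exp_le_chord:
  fixes c x :: real
  assumes "0 < c" "\<bar>x\<bar> \<le> c"
  shows "exp x \<le> cosh c + x * (sinh c / c)"
proof -
  define u where "u = (c + x) / (2 * c)"
  have u: "0 \<le> u" "u \<le> 1"
    using assms by (auto simp: u_def field_simps)
  have x: "x = (1 - u) * (- c) + u * c"
    using assms by (simp add: u_def field_simps)
  have "exp x \<le> (1 - u) * exp (- c) + u * exp c"
    using convex_onD[OF convex_on_exp[of 1], of u "- c" c] u x by simp
  also have "\<dots> = cosh c + x * (sinh c / c)"
    using assms by (simp add: u_def cosh_def sinh_def field_simps)
  finally show ?thesis .
qed

text \<open>The chord over [-c, c], evaluated at \<open>\<mu>\<close>, is the exponential moment of
  the law on {-c, c} with mean \<open>\<mu>\<close>, so this is Hoeffding's lemma for that law.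
  Since the right side of \<open>exp_le_chord\<close> is affine in \<open>x\<close>, it commutes
  with averaging, and the pair yields Hoeffding's lemma for conditional and for finite means
  alike.\<close>

lemma chord_le_exp:
  fixes c \<mu> :: real
  assumes "0 < c" "\<bar>\<mu>\<bar> \<le> c"
  shows "cosh c + \<mu> * (sinh c / c) \<le> exp (\<mu> + c\<^sup>2 / 2)"
proof -
  \<comment> \<open>The mass at \<open>c\<close> of the two-point law. Its support has length
    \<open>2 * c\<close>, hence the term \<open>(2 * c)\<^sup>2 / 8\<close>.\<close>
  define p where "p = (c + \<mu>) / (2 * c)"
  have p: "0 \<le> p" "p \<le> 1"
    using assms by (auto simp: p_def field_simps)
  have pos: "0 < 1 + p * (exp (2 * c) - 1)"
    using p assms by (intro add_pos_nonneg mult_nonneg_nonneg) auto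
  have "cosh c + \<mu> * (sinh c / c) = (1 - p) * exp (- c) + p * exp c"
    using assms by (simp add: p_def cosh_def sinh_def field_simps)
  also have "\<dots> = exp (- c) * (1 + p * (exp (2 * c) - 1))"
    by (simp add: algebra_simps flip: exp_add)
  also have "\<dots> = exp (- c + ln (1 + p * (exp (2 * c) - 1)))"
    using pos by (simp only: exp_add exp_ln)
  also have "\<dots> \<le> exp (- c + (2 * c * p + (2 * c)\<^sup>2 / 8))"
    using Hoeffdings_lemma_aux[of "2 * c" p] p assms by simp
  also have "- c + (2 * c * p + (2 * c)\<^sup>2 / 8) = \<mu> + c\<^sup>2 / 2"
    using assms by (simp add: p_def field_simps power2_eq_square)
  finally show ?thesis .
qed

text \<open>Each round multiplies the moment by at most \<open>exp ((s * a)\<^sup>2 / 2)\<close>.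
  The increments are centred at the conditional mean, but only \<open>Y t\<close> itself has to lie
  in [-a, a]; bounding the increments by \<open>2 * a\<close> would give four times this
  exponent.\<close>

lemma azuma_exp_moment:
  fixes F :: "nat \<Rightarrow> 'w measure" and Y :: "nat \<Rightarrow> 'w \<Rightarrow> real"
  assumes "prob_space P"
    and sub: "\<And>t. t \<in> {1..T} \<Longrightarrow> subalgebra P (F t)"
    and filt: "\<And>s t. 1 \<le> s \<Longrightarrow> s < t \<Longrightarrow> t \<le> T \<Longrightarrow> subalgebra (F t) (F s)"
    and meas: "\<And>t. t \<in> {1..T} \<Longrightarrow> Y t \<in> borel_measurable P"
    and adapted: "\<And>s t. 1 \<le> s \<Longrightarrow> s < t \<Longrightarrow> t \<le> T \<Longrightarrow> Y s \<in> borel_measurable (F t)"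
    and bound: "\<And>t. t \<in> {1..T} \<Longrightarrow> AE \<omega> in P. \<bar>Y t \<omega>\<bar> \<le> a"
    and "0 < a" "0 < s" "k \<le> T"
  defines "S \<equiv> \<lambda>k \<omega>. \<Sum>t=1..k. real_cond_exp P (F t) (Y t) \<omega> - Y t \<omega>"
  shows "integrable P (\<lambda>\<omega>. exp (s * S k \<omega>))"
    and "(\<integral>\<omega>. exp (s * S k \<omega>) \<partial>P) \<le> exp (real k * (s * a)\<^sup>2 / 2)"
proof -
  interpret prob_space P by fact
  define \<mu> where "\<mu> t = real_cond_exp P (F t) (Y t)" for t
  have \<mu>_F: "\<mu> t \<in> borel_measurable (F t)" for t
    by (simp add: \<mu>_def)
  have \<mu>_P: "\<mu> t \<in> borel_measurable P" if "t \<in> {1..T}" for t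
    using measurable_from_subalg[OF sub[OF that] \<mu>_F] .
  have intY: "integrable P (Y t)" if "t \<in> {1..T}" for t
    using bound[OF that] meas[OF that] by (intro integrable_const_bound[of _ a]) auto
  have \<mu>_bound: "AE \<omega> in P. \<bar>\<mu> t \<omega>\<bar> \<le> a" if t: "t \<in> {1..T}" for t
  proof -
    interpret finite_measure_subalgebra P "F t"
      by unfold_locales (rule sub[OF t])
    have "AE \<omega> in P. Y t \<omega> \<le> a" "AE \<omega> in P. Y t \<omega> \<ge> - a"
      using bound[OF t] by (auto elim: eventually_mono)
    from real_cond_exp_le_c[OF intY[OF t] this(1)] real_cond_exp_ge_c[OF intY[OF t] this(2)]
    show ?thesis by eventually_elim (simp add: \<mu>_def abs_le_iff)
  qed
  have S_P: "S k \<in> borel_measurable P" if "k \<le> T" for k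
    unfolding S_def using that meas \<mu>_P
    by (intro borel_measurable_sum borel_measurable_diff) (auto simp: \<mu>_def)
  have S_F: "S k \<in> borel_measurable (F (Suc k))" if "Suc k \<le> T" for k
    unfolding S_def using that adapted measurable_from_subalg[OF filt \<mu>_F]
    by (intro borel_measurable_sum borel_measurable_diff) (auto simp: \<mu>_def)
  have S_bound: "AE \<omega> in P. \<bar>S k \<omega>\<bar> \<le> 2 * a * real k" if "k \<le> T" for k
  proof -
    have "AE \<omega> in P. \<forall>t\<in>{1..k}. \<bar>\<mu> t \<omega>\<bar> \<le> a \<and> \<bar>Y t \<omega>\<bar> \<le> a"
      using that bound \<mu>_bound by (intro AE_finite_allI) auto
    then show ?thesis
    proof eventually_elim
      case (elim \<omega>)
      have "\<bar>S k \<omega>\<bar> \<le> (\<Sum>t=1..k. \<bar>\<mu> t \<omega> - Y t \<omega>\<bar>)"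
        unfolding S_def \<mu>_def by (rule sum_abs)
      also have "\<dots> \<le> (\<Sum>t=1..k. 2 * a)"
        using elim by (intro sum_mono) (fastforce simp: abs_le_iff)
      finally show ?case by (simp add: mult_ac)
    qed
  qed
  have int_exp: "integrable P (\<lambda>\<omega>. exp (s * S k \<omega>))" if "k \<le> T" for k
  proof (rule integrable_const_bound)
    show "AE \<omega> in P. norm (exp (s * S k \<omega>)) \<le> exp (s * (2 * a * real k))"
      using S_bound[OF that] by eventually_elim (use \<open>0 < s\<close> in auto)
  qed (use S_P[OF that] in measurable)
  then show "integrable P (\<lambda>\<omega>. exp (s * S k \<omega>))"
    using \<open>k \<le> T\<close> .
  define c where "c = s * a"
  have "0 < c" using assms by (simp add: c_def)
  define \<kappa> where "\<kappa> = sinh c / c"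
  show "(\<integral>\<omega>. exp (s * S k \<omega>) \<partial>P) \<le> exp (real k * (s * a)\<^sup>2 / 2)"
    using \<open>k \<le> T\<close>
  proof (induction k)
    case 0
    then show ?case by (simp add: S_def prob_space)
  next
    case (Suc k)
    define t where "t = Suc k"
    have t: "t \<in> {1..T}" using Suc.prems by (simp add: t_def)
    interpret G: finite_measure_subalgebra P "F t"
      by unfold_locales (rule sub[OF t])
    \<comment> \<open>All that is known before the draw of round \<open>t\<close>, including the
      centre \<open>\<mu> t\<close>. Only the exponential of \<open>- s * Y t\<close> is left over,
      and the chord bound makes it affine in \<open>Y t\<close>.\<close>
    define V where "V \<omega> = exp (s * S k \<omega>) * exp (s * \<mu> t \<omega>)" for \<omega>
    have V_F [measurable]: "V \<in> borel_measurable (F t)"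
      using S_F[of k] \<mu>_F[of t] Suc.prems unfolding V_def t_def by measurable
    have V_P [measurable]: "V \<in> borel_measurable P"
      by (rule measurable_from_subalg[OF sub[OF t] V_F])
    note [measurable] = meas[OF t] \<mu>_P[OF t]
    define C where "C = exp (s * (2 * a * real k)) * exp (s * a)"
    have V_bound: "AE \<omega> in P. \<bar>V \<omega>\<bar> \<le> C"
      using S_bound[OF Suc_leD[OF Suc.prems]] \<mu>_bound[OF t]
    proof eventually_elim
      case (elim \<omega>)
      then show ?case
        unfolding V_def C_def abs_mult using \<open>0 < s\<close> by (intro mult_mono) auto
    qed
    have intV: "integrable P V"
      using V_bound by (intro integrable_const_bound[of _ C]) auto
    have intVY: "integrable P (\<lambda>\<omega>. V \<omega> * Y t \<omega>)"
    proof (rule integrable_const_bound[of _ "C * a"])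
      show "AE \<omega> in P. norm (V \<omega> * Y t \<omega>) \<le> C * a"
        using V_bound bound[OF t]
        by eventually_elim (auto simp: abs_mult C_def intro!: mult_mono)
    qed measurable
    \<comment> \<open>As \<open>V\<close> is measurable for \<open>F t\<close>, \<open>Y t\<close>
      may be traded for its conditional mean under the integral against \<open>V\<close>.\<close>
    have VY: "integrable P (\<lambda>\<omega>. V \<omega> * \<mu> t \<omega>)"
      "(\<integral>\<omega>. V \<omega> * \<mu> t \<omega> \<partial>P) = (\<integral>\<omega>. V \<omega> * Y t \<omega> \<partial>P)"
      unfolding \<mu>_def using G.real_cond_exp_intg[OF intVY V_F meas[OF t]] by auto
    have S_Suc: "exp (s * S (Suc k) \<omega>) = V \<omega> * exp (- (s * Y t \<omega>))" for \<omega>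
      by (simp add: S_def V_def \<mu>_def t_def algebra_simps flip: exp_add)
    have "(\<integral>\<omega>. exp (s * S (Suc k) \<omega>) \<partial>P)
        \<le> (\<integral>\<omega>. cosh c * V \<omega> - s * \<kappa> * (V \<omega> * Y t \<omega>) \<partial>P)"
    proof (rule integral_mono_AE[OF int_exp[OF Suc.prems]])
      show "AE \<omega> in P. exp (s * S (Suc k) \<omega>) \<le> cosh c * V \<omega> - s * \<kappa> * (V \<omega> * Y t \<omega>)"
        using bound[OF t]
      proof eventually_elim
        case (elim \<omega>)
        have "\<bar>- (s * Y t \<omega>)\<bar> \<le> c"
          using elim \<open>0 < s\<close> by (simp add: c_def abs_mult)
        then have "V \<omega> * exp (- (s * Y t \<omega>)) \<le> V \<omega> * (cosh c + - (s * Y t \<omega>) * \<kappa>)"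
          unfolding \<kappa>_def by (intro mult_left_mono exp_le_chord \<open>0 < c\<close>) (auto simp: V_def)
        then show ?case by (simp add: S_Suc algebra_simps)
      qed
    qed (use intV intVY in auto)
    also have "\<dots> = (\<integral>\<omega>. cosh c * V \<omega> - s * \<kappa> * (V \<omega> * \<mu> t \<omega>) \<partial>P)"
      using intV intVY VY by simp
    \<comment> \<open>Back from the chord to an exponential, whose part \<open>- s * \<mu> t\<close>
      cancels the centre contained in \<open>V\<close>.\<close>
    also have "\<dots> \<le> (\<integral>\<omega>. exp (s * S k \<omega>) * exp (c\<^sup>2 / 2) \<partial>P)"
    proof (rule integral_mono_AE)
      show "AE \<omega> in P. cosh c * V \<omega> - s * \<kappa> * (V \<omega> * \<mu> t \<omega>) \<le> exp (s * S k \<omega>) * exp (c\<^sup>2 / 2)"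
        using \<mu>_bound[OF t]
      proof eventually_elim
        case (elim \<omega>)
        have "\<bar>- (s * \<mu> t \<omega>)\<bar> \<le> c"
          using elim \<open>0 < s\<close> by (simp add: c_def abs_mult)
        then have "V \<omega> * (cosh c + - (s * \<mu> t \<omega>) * \<kappa>) \<le> V \<omega> * exp (- (s * \<mu> t \<omega>) + c\<^sup>2 / 2)"
          unfolding \<kappa>_def by (intro mult_left_mono chord_le_exp \<open>0 < c\<close>) (auto simp: V_def)
        then show ?case by (simp add: V_def algebra_simps flip: exp_add)
      qed
    qed (use intV VY int_exp[of k] Suc.prems in auto)
    also have "\<dots> \<le> exp (real k * (s * a)\<^sup>2 / 2) * exp (c\<^sup>2 / 2)"
      using Suc by simp
    also have "\<dots> = exp (real (Suc k) * (s * a)\<^sup>2 / 2)"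
      by (simp add: c_def field_simps flip: exp_add)
    finally show ?case .
  qed
qed

lemma azuma_hoeffding:
  fixes F :: "nat \<Rightarrow> 'w measure" and Y :: "nat \<Rightarrow> 'w \<Rightarrow> real"
  assumes "prob_space P"
    and sub: "\<And>t. t \<in> {1..T} \<Longrightarrow> subalgebra P (F t)"
    and filt: "\<And>s t. 1 \<le> s \<Longrightarrow> s < t \<Longrightarrow> t \<le> T \<Longrightarrow> subalgebra (F t) (F s)"
    and meas: "\<And>t. t \<in> {1..T} \<Longrightarrow> Y t \<in> borel_measurable P"
    and adapted: "\<And>s t. 1 \<le> s \<Longrightarrow> s < t \<Longrightarrow> t \<le> T \<Longrightarrow> Y s \<in> borel_measurable (F t)"
    and bound: "\<And>t. t \<in> {1..T} \<Longrightarrow> AE \<omega> in P. \<bar>Y t \<omega>\<bar> \<le> a"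
    and "0 < a" "1 \<le> T" "0 < \<delta>" "\<delta> < 1"
  shows "measure P {\<omega> \<in> space P. a * sqrt (2 * real T * ln (1 / \<delta>))
    < (\<Sum>t=1..T. real_cond_exp P (F t) (Y t) \<omega> - Y t \<omega>)} \<le> \<delta>"
proof -
  interpret prob_space P by fact
  define S where "S \<omega> = (\<Sum>t=1..T. real_cond_exp P (F t) (Y t) \<omega> - Y t \<omega>)" for \<omega>
  define L where "L = ln (1 / \<delta>)"
  define \<epsilon> where "\<epsilon> = a * sqrt (2 * real T * L)"
  have "0 < L" using assms by (simp add: L_def)
  then have "0 < \<epsilon>" using assms by (simp add: \<epsilon>_def)
  \<comment> \<open>The minimiser of the Chernoff exponent
    \<open>T * (s * a)\<^sup>2 / 2 - s * \<epsilon>\<close>, whose two terms become \<open>L\<close>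
    and \<open>2 * L\<close>.\<close>
  define s where "s = \<epsilon> / (real T * a\<^sup>2)"
  have "0 < s" using \<open>0 < \<epsilon>\<close> assms by (simp add: s_def)
  have eps2: "\<epsilon>\<^sup>2 = 2 * real T * a\<^sup>2 * L"
    using \<open>0 < L\<close> by (simp add: \<epsilon>_def power_mult_distrib)
  have expo: "s * \<epsilon> = 2 * L" "real T * (s * a)\<^sup>2 / 2 = L"
  proof -
    have "s * \<epsilon> = \<epsilon>\<^sup>2 / (real T * a\<^sup>2)"
      by (simp add: s_def power2_eq_square)
    also have "\<dots> = 2 * L"
      using assms by (simp add: eps2)
    finally show *: "s * \<epsilon> = 2 * L" .
    have "real T * (s * a)\<^sup>2 / 2 = s * (s * (real T * a\<^sup>2)) / 2"
      by (simp add: power2_eq_square)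
    also have "s * (real T * a\<^sup>2) = \<epsilon>"
      using assms by (simp add: s_def)
    finally show "real T * (s * a)\<^sup>2 / 2 = L" using * by simp
  qed
  note moment = azuma_exp_moment[where P = P and F = F and Y = Y and a = a and k = T and T = T
      and s = s, OF assms(1) sub filt meas adapted bound \<open>0 < a\<close> \<open>0 < s\<close> order_refl,
      folded S_def]
  have "measure P {\<omega> \<in> space P. \<epsilon> < S \<omega>}
      \<le> measure P {\<omega> \<in> space P. exp (s * \<epsilon>) \<le> exp (s * S \<omega>)}"
  proof (rule finite_measure_mono)
    show "{\<omega> \<in> space P. exp (s * \<epsilon>) \<le> exp (s * S \<omega>)} \<in> sets P"
      using borel_measurable_integrable[OF moment(1)] by measurable
  qed (use \<open>0 < s\<close> in auto)
  also have "\<dots> \<le> (\<integral>\<omega>. exp (s * S \<omega>) \<partial>P) / exp (s * \<epsilon>)"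
    by (rule integral_Markov_inequality_measure[where A = "{}"]) (use moment in auto)
  also have "\<dots> \<le> exp L / exp (2 * L)"
    using moment(2) unfolding expo by (auto intro: divide_right_mono)
  also have "\<dots> = exp (- L)"
    by (simp flip: exp_diff)
  also have "\<dots> = \<delta>"
    using assms by (simp add: L_def ln_div)
  finally show ?thesis by (simp add: \<epsilon>_def S_def L_def)
qed

subsection \<open>Conditional expectations of random vectors\<close>

lemma borel_measurable_vec_iff:
  fixes f :: "'w \<Rightarrow> real ^ 'n"
  shows "f \<in> borel_measurable M \<longleftrightarrow> (\<forall>i. (\<lambda>\<omega>. f \<omega> $ i) \<in> borel_measurable M)"
  by (subst borel_measurable_euclidean_space) (auto simp: Basis_vec_def inner_axis)

lemma vec_cond_exp_measurable [measurable]: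
  "vec_cond_exp P F X \<in> borel_measurable F"
  by (simp add: borel_measurable_vec_iff vec_cond_exp_def)

lemma real_cond_exp_inner:
  fixes X Z :: "'w \<Rightarrow> real ^ 'n"
  assumes "prob_space P" and sub: "subalgebra P F"
    and Z: "Z \<in> borel_measurable F" and X: "X \<in> borel_measurable P"
    and Z_bound: "AE \<omega> in P. norm (Z \<omega>) \<le> C" and X_bound: "AE \<omega> in P. norm (X \<omega>) \<le> D"
  shows "AE \<omega> in P. real_cond_exp P F (\<lambda>\<omega>. Z \<omega> \<bullet> X \<omega>) \<omega> = Z \<omega> \<bullet> vec_cond_exp P F X \<omega>"
proof -
  interpret prob_space P by fact
  interpret finite_measure_subalgebra P F by unfold_locales (rule sub)
  have Zi: "(\<lambda>\<omega>. Z \<omega> $ i) \<in> borel_measurable F" for i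
    using Z by (simp add: borel_measurable_vec_iff)
  have Xi: "(\<lambda>\<omega>. X \<omega> $ i) \<in> borel_measurable P" for i
    using X by (simp add: borel_measurable_vec_iff)
  have int: "integrable P (\<lambda>\<omega>. Z \<omega> $ i * X \<omega> $ i)" for i
  proof (rule integrable_const_bound[of _ "C * D"])
    show "AE \<omega> in P. norm (Z \<omega> $ i * X \<omega> $ i) \<le> C * D"
      using Z_bound X_bound
    proof eventually_elim
      case (elim \<omega>)
      have "\<bar>Z \<omega> $ i\<bar> \<le> C" "\<bar>X \<omega> $ i\<bar> \<le> D"
        using elim component_le_norm_cart[of "Z \<omega>" i] component_le_norm_cart[of "X \<omega>" i] by linarith+
      then show ?case by (auto simp: abs_mult intro!: mult_mono)
    qed
  qed (intro borel_measurable_times Xi measurable_from_subalg[OF sub Zi])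
  have "AE \<omega> in P. \<forall>i. real_cond_exp P F (\<lambda>\<omega>. Z \<omega> $ i * X \<omega> $ i) \<omega>
      = Z \<omega> $ i * vec_cond_exp P F X \<omega> $ i"
    unfolding AE_all_countable using real_cond_exp_mult[OF Zi Xi int] by (simp add: vec_cond_exp_def)
  moreover have "AE \<omega> in P. real_cond_exp P F (\<lambda>\<omega>. \<Sum>i\<in>UNIV. Z \<omega> $ i * X \<omega> $ i) \<omega>
      = (\<Sum>i\<in>UNIV. real_cond_exp P F (\<lambda>\<omega>. Z \<omega> $ i * X \<omega> $ i) \<omega>)"
    by (rule real_cond_exp_sum[OF int])
  ultimately show ?thesis
    by eventually_elim (simp add: inner_vec_def)
qed

text \<open>A coordinatewise estimate would lose a dimension factor. Instead \<open>X\<close> is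
  paired with the direction of its own conditional mean, which is known to \<open>F\<close> and can
  be pulled out; Cauchy-Schwarz is applied before conditioning.\<close>

lemma norm_vec_cond_exp_le:
  fixes X :: "'w \<Rightarrow> real ^ 'n"
  assumes "prob_space P" and sub: "subalgebra P F" and X: "X \<in> borel_measurable P"
    and X_bound: "AE \<omega> in P. norm (X \<omega>) \<le> D"
  shows "AE \<omega> in P. norm (vec_cond_exp P F X \<omega>) \<le> D"
proof -
  interpret prob_space P by fact
  interpret finite_measure_subalgebra P F by unfold_locales (rule sub)
  define G where "G = vec_cond_exp P F X"
  \<comment> \<open>Where \<open>G\<close> vanishes, \<open>inverse 0 = 0\<close> makes
    \<open>Z\<close> zero, so \<open>Z\<close> lies in the unit ball everywhere.\<close>
  define Z where "Z \<omega> = inverse (norm (G \<omega>)) *\<^sub>R G \<omega>" for \<omega>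
  have G_F [measurable]: "G \<in> borel_measurable F" by (simp add: G_def)
  have Z_F: "Z \<in> borel_measurable F" unfolding Z_def by measurable
  have Z_bound: "norm (Z \<omega>) \<le> 1" for \<omega>
    by (cases "G \<omega> = 0") (auto simp: Z_def)
  have ZX: "AE \<omega> in P. Z \<omega> \<bullet> X \<omega> \<le> D \<and> \<bar>Z \<omega> \<bullet> X \<omega>\<bar> \<le> D"
    using X_bound
  proof eventually_elim
    case (elim \<omega>)
    have "\<bar>Z \<omega> \<bullet> X \<omega>\<bar> \<le> norm (Z \<omega>) * norm (X \<omega>)" by (rule Cauchy_Schwarz_ineq2)
    also have "\<dots> \<le> 1 * D" using elim Z_bound by (intro mult_mono) auto
    finally show ?case by auto
  qed
  have "integrable P (\<lambda>\<omega>. Z \<omega> \<bullet> X \<omega>)"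
    using ZX by (intro integrable_const_bound[of _ D] borel_measurable_inner X
        measurable_from_subalg[OF sub Z_F]) (auto elim: eventually_mono)
  then have "AE \<omega> in P. real_cond_exp P F (\<lambda>\<omega>. Z \<omega> \<bullet> X \<omega>) \<omega> \<le> D"
    using ZX by (intro real_cond_exp_le_c) (auto elim: eventually_mono)
  moreover have "AE \<omega> in P. real_cond_exp P F (\<lambda>\<omega>. Z \<omega> \<bullet> X \<omega>) \<omega> = Z \<omega> \<bullet> G \<omega>"
    unfolding G_def using Z_bound by (intro real_cond_exp_inner[OF assms(1) sub Z_F X _ X_bound, of 1]) auto
  ultimately show ?thesis
  proof eventually_elim
    case (elim \<omega>)
    have "Z \<omega> \<bullet> G \<omega> = norm (G \<omega>)"
      by (cases "G \<omega> = 0") (auto simp: Z_def dot_square_norm power2_eq_square)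
    then show ?case using elim by (simp add: G_def)
  qed
qed

lemma abs_vec_cond_exp_nth_le:
  fixes X :: "'w \<Rightarrow> real ^ 'n"
  assumes "prob_space P" and sub: "subalgebra P F" and X: "X \<in> borel_measurable P"
    and X_bound: "AE \<omega> in P. \<bar>X \<omega> $ i\<bar> \<le> b"
  shows "AE \<omega> in P. \<bar>vec_cond_exp P F X \<omega> $ i\<bar> \<le> b"
proof -
  interpret prob_space P by fact
  interpret finite_measure_subalgebra P F by unfold_locales (rule sub)
  have int: "integrable P (\<lambda>\<omega>. X \<omega> $ i)"
    using X X_bound by (intro integrable_const_bound[of _ b]) (auto simp: borel_measurable_vec_iff)
  have "AE \<omega> in P. X \<omega> $ i \<le> b" "AE \<omega> in P. X \<omega> $ i \<ge> - b"
    using X_bound by (auto elim: eventually_mono)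
  from real_cond_exp_le_c[OF int this(1)] real_cond_exp_ge_c[OF int this(2)]
  show ?thesis
    by eventually_elim (auto simp: vec_cond_exp_def)
qed

text \<open>\<open>C\<close> and \<open>D\<close> ensure integrability, while the rate depends on
  \<open>a\<close> alone. This keeps the duality of the l1 and sup norms available to the
  multipliers, where \<open>a\<close> is smaller than \<open>C * D\<close> by the factor
  \<open>CARD('n)\<close>.\<close>

lemma azuma_hoeffding_inner:
  fixes F :: "nat \<Rightarrow> 'w measure" and X Z :: "nat \<Rightarrow> 'w \<Rightarrow> real ^ 'n"
  assumes "prob_space P"
    and sub: "\<And>t. t \<in> {1..T} \<Longrightarrow> subalgebra P (F t)"
    and filt: "\<And>s t. 1 \<le> s \<Longrightarrow> s < t \<Longrightarrow> t \<le> T \<Longrightarrow> subalgebra (F t) (F s)"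
    and X: "\<And>t. t \<in> {1..T} \<Longrightarrow> X t \<in> borel_measurable P"
    and adapted: "\<And>s t. 1 \<le> s \<Longrightarrow> s < t \<Longrightarrow> t \<le> T \<Longrightarrow> X s \<in> borel_measurable (F t)"
    and Z: "\<And>t. t \<in> {1..T} \<Longrightarrow> Z t \<in> borel_measurable (F t)"
    and X_bound: "\<And>t. t \<in> {1..T} \<Longrightarrow> AE \<omega> in P. norm (X t \<omega>) \<le> D"
    and Z_bound: "\<And>t. t \<in> {1..T} \<Longrightarrow> AE \<omega> in P. norm (Z t \<omega>) \<le> C"
    and bound: "\<And>t. t \<in> {1..T} \<Longrightarrow> AE \<omega> in P. \<bar>Z t \<omega> \<bullet> X t \<omega>\<bar> \<le> a"
    and "0 < a" "1 \<le> T" "0 < \<delta>" "\<delta> < 1"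
  shows "measure P {\<omega> \<in> space P. a * sqrt (2 * real T * ln (1 / \<delta>))
    < (\<Sum>t=1..T. Z t \<omega> \<bullet> (vec_cond_exp P (F t) (X t) \<omega> - X t \<omega>))} \<le> \<delta>"
proof -
  interpret prob_space P by fact
  define Y where "Y t \<omega> = Z t \<omega> \<bullet> X t \<omega>" for t \<omega>
  have Y_P: "Y t \<in> borel_measurable P" if "t \<in> {1..T}" for t
    unfolding Y_def using that
    by (intro borel_measurable_inner X measurable_from_subalg[OF sub Z])
  have Y_F: "Y s \<in> borel_measurable (F t)" if "1 \<le> s" "s < t" "t \<le> T" for s t
    unfolding Y_def using that
    by (intro borel_measurable_inner adapted measurable_from_subalg[OF filt Z]) auto
  have cond: "AE \<omega> in P. \<forall>t\<in>{1..T}.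
      real_cond_exp P (F t) (Y t) \<omega> = Z t \<omega> \<bullet> vec_cond_exp P (F t) (X t) \<omega>"
    unfolding Y_def
    by (intro AE_finite_allI) (auto intro!: real_cond_exp_inner assms)
  note [measurable] = Y_P X measurable_from_subalg[OF sub Z]
    measurable_from_subalg[OF sub vec_cond_exp_measurable]
    measurable_from_subalg[OF sub borel_measurable_cond_exp]
  have "measure P {\<omega> \<in> space P. a * sqrt (2 * real T * ln (1 / \<delta>))
      < (\<Sum>t=1..T. Z t \<omega> \<bullet> (vec_cond_exp P (F t) (X t) \<omega> - X t \<omega>))}
    = measure P {\<omega> \<in> space P. a * sqrt (2 * real T * ln (1 / \<delta>))
      < (\<Sum>t=1..T. real_cond_exp P (F t) (Y t) \<omega> - Y t \<omega>)}"
  \<comment> \<open>The events agree up to a null set: \<open>Z t\<close> leaves the conditional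
    expectation only almost surely.\<close>
  proof (rule finite_measure_eq_AE)
    show "AE \<omega> in P. (\<omega> \<in> {\<omega> \<in> space P. a * sqrt (2 * real T * ln (1 / \<delta>))
        < (\<Sum>t=1..T. Z t \<omega> \<bullet> (vec_cond_exp P (F t) (X t) \<omega> - X t \<omega>))})
      = (\<omega> \<in> {\<omega> \<in> space P. a * sqrt (2 * real T * ln (1 / \<delta>))
        < (\<Sum>t=1..T. real_cond_exp P (F t) (Y t) \<omega> - Y t \<omega>)})"
      using cond by eventually_elim (simp add: Y_def inner_diff_right)
  qed measurable
  also have "\<dots> \<le> \<delta>"
    by (rule azuma_hoeffding[OF assms(1) sub filt Y_P Y_F]) (use assms in \<open>auto simp: Y_def\<close>)
  finally show ?thesis .
qed

subsection \<open>Deterministic regret bounds\<close>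

text \<open>Projection onto \<open>\<Theta>\<close> is nonexpansive and fixes \<open>y\<close>;
  expanding the square isolates the linear term.\<close>

lemma projected_step:
  fixes \<Theta> :: "'a::euclidean_space set"
  assumes "closed \<Theta>" "convex \<Theta>" "y \<in> \<Theta>"
  shows "2 * \<eta> * (d \<bullet> (x - y))
    \<le> (norm (x - y))\<^sup>2 - (norm (closest_point \<Theta> (x - \<eta> *\<^sub>R d) - y))\<^sup>2 + \<eta>\<^sup>2 * (norm d)\<^sup>2"
proof -
  have "norm (closest_point \<Theta> (x - \<eta> *\<^sub>R d) - y) \<le> norm (x - \<eta> *\<^sub>R d - y)"
    using closest_point_lipschitz[of \<Theta> "x - \<eta> *\<^sub>R d" y] closest_point_self[of y \<Theta>] assms
    by (auto simp: dist_norm)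
  then have "(norm (closest_point \<Theta> (x - \<eta> *\<^sub>R d) - y))\<^sup>2 \<le> (norm (x - y - \<eta> *\<^sub>R d))\<^sup>2"
    by (intro power_mono) (auto simp: algebra_simps)
  also have "\<dots> = (norm (x - y))\<^sup>2 - 2 * \<eta> * (d \<bullet> (x - y)) + \<eta>\<^sup>2 * (norm d)\<^sup>2"
    unfolding power2_norm_eq_inner
    by (simp add: inner_diff_left inner_diff_right inner_commute power2_eq_square algebra_simps)
  finally show ?thesis by simp
qed

text \<open>The squared distances to \<open>y\<close> telescope. The vectors \<open>d\<close> are
  arbitrary, not gradients of a function, so the bound serves the actual draws and the noise
  alike.\<close>

lemma projected_gradient_regret:
  fixes \<Theta> :: "'a::euclidean_space set" and x d :: "nat \<Rightarrow> 'a"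
  assumes "closed \<Theta>" "convex \<Theta>" "y \<in> \<Theta>" "0 < \<eta>"
    and step: "\<And>t. t \<in> {1..T} \<Longrightarrow> x (t + 1) = closest_point \<Theta> (x t - \<eta> *\<^sub>R d t)"
    and bound: "\<And>t. t \<in> {1..T} \<Longrightarrow> norm (d t) \<le> G"
  shows "(\<Sum>t=1..T. d t \<bullet> (x t - y)) \<le> (norm (x 1 - y))\<^sup>2 / (2 * \<eta>) + \<eta> * real T * G\<^sup>2 / 2"
proof -
  have "2 * \<eta> * (\<Sum>t=1..T. d t \<bullet> (x t - y)) = (\<Sum>t=1..T. 2 * \<eta> * (d t \<bullet> (x t - y)))"
    by (simp add: sum_distrib_left)
  also have "\<dots> \<le> (\<Sum>t=1..T. (norm (x t - y))\<^sup>2 - (norm (x (Suc t) - y))\<^sup>2 + \<eta>\<^sup>2 * G\<^sup>2)"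
  proof (rule sum_mono)
    fix t assume t: "t \<in> {1..T}"
    have "\<eta>\<^sup>2 * (norm (d t))\<^sup>2 \<le> \<eta>\<^sup>2 * G\<^sup>2"
      using bound[OF t] by (intro mult_left_mono power_mono) auto
    then show "2 * \<eta> * (d t \<bullet> (x t - y))
        \<le> (norm (x t - y))\<^sup>2 - (norm (x (Suc t) - y))\<^sup>2 + \<eta>\<^sup>2 * G\<^sup>2"
      using projected_step[OF assms(1-3), of \<eta> "d t" "x t"] step[OF t] by simp
  qed
  also have "\<dots> = - (\<Sum>t=1..T. (norm (x (Suc t) - y))\<^sup>2 - (norm (x t - y))\<^sup>2) + real T * (\<eta>\<^sup>2 * G\<^sup>2)"
    by (simp add: sum.distrib sum_subtractf)
  also have "(\<Sum>t=1..T. (norm (x (Suc t) - y))\<^sup>2 - (norm (x t - y))\<^sup>2)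
      = (norm (x (Suc T) - y))\<^sup>2 - (norm (x 1 - y))\<^sup>2"
    by (rule sum_Suc_diff) simp
  finally have "2 * \<eta> * (\<Sum>t=1..T. d t \<bullet> (x t - y)) \<le> (norm (x 1 - y))\<^sup>2 + real T * (\<eta>\<^sup>2 * G\<^sup>2)"
    by (smt (verit) zero_le_power2)
  then have "(\<Sum>t=1..T. d t \<bullet> (x t - y)) \<le> ((norm (x 1 - y))\<^sup>2 + real T * (\<eta>\<^sup>2 * G\<^sup>2)) / (2 * \<eta>)"
    using \<open>0 < \<eta>\<close> by (simp add: field_simps)
  also have "\<dots> = (norm (x 1 - y))\<^sup>2 / (2 * \<eta>) + \<eta> * real T * G\<^sup>2 / 2"
    using \<open>0 < \<eta>\<close> by (simp add: field_simps power2_eq_square)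
  finally show ?thesis .
qed

section \<open>Multiplicative weights on the columns of a stochastic matrix\<close>

definition positive_stochastic :: "(real ^ 'n ^ 'n) set" where
  "positive_stochastic = {A. (\<forall>i j. 0 < A $ i $ j) \<and> (\<forall>j. (\<Sum>i\<in>UNIV. A $ i $ j) = 1)}"

text \<open>Hoeffding's lemma for a finite distribution, by the same two chord bounds as in the
  martingale part.\<close>

lemma exp_mean_le:
  fixes p x :: "'i \<Rightarrow> real"
  assumes "finite I" "\<And>i. i \<in> I \<Longrightarrow> 0 \<le> p i" "sum p I = 1" "\<And>i. i \<in> I \<Longrightarrow> \<bar>x i\<bar> \<le> c" "0 < c"
  shows "(\<Sum>i\<in>I. p i * exp (x i)) \<le> exp ((\<Sum>i\<in>I. p i * x i) + c\<^sup>2 / 2)"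
proof -
  have "\<bar>\<Sum>i\<in>I. p i * x i\<bar> \<le> (\<Sum>i\<in>I. p i * c)"
    using assms by (intro order_trans[OF sum_abs] sum_mono) (auto simp: abs_mult intro: mult_left_mono)
  then have mean: "\<bar>\<Sum>i\<in>I. p i * x i\<bar> \<le> c"
    using assms by (simp flip: sum_distrib_right)
  have "(\<Sum>i\<in>I. p i * exp (x i)) \<le> (\<Sum>i\<in>I. p i * (cosh c + x i * (sinh c / c)))"
    using assms by (intro sum_mono mult_left_mono exp_le_chord) auto
  also have "\<dots> = cosh c * sum p I + (\<Sum>i\<in>I. p i * x i) * (sinh c / c)"
    by (simp add: distrib_left sum.distrib sum_distrib_left sum_distrib_right mult_ac)
  also have "\<dots> \<le> exp ((\<Sum>i\<in>I. p i * x i) + c\<^sup>2 / 2)"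
    using chord_le_exp[OF \<open>0 < c\<close> mean] assms by simp
  finally show ?thesis .
qed

definition update_step :: "real \<Rightarrow> real ^ 'n ^ 'n \<Rightarrow> real ^ 'n \<Rightarrow> real ^ 'n \<Rightarrow> real ^ 'n ^ 'n" where
  "update_step \<eta> A D l = normalize_columns (exp_update \<eta> A D l)"

lemma update_step_nth:
  assumes "A \<in> positive_stochastic"
  shows "update_step \<eta> A D l $ i $ j
    = A $ i $ j * exp (\<eta> * D $ i * l $ j) / (\<Sum>k\<in>UNIV. A $ k $ j * exp (\<eta> * D $ k * l $ j))"
proof -
  have "\<bar>A $ k $ j * exp (\<eta> * D $ k * l $ j)\<bar> = A $ k $ j * exp (\<eta> * D $ k * l $ j)" for k
    using assms by (simp add: positive_stochastic_def abs_mult less_imp_le)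
  then show ?thesis
    by (simp add: update_step_def normalize_columns_def exp_update_def l1_norm_def column_def)
qed

lemma update_step_positive_stochastic:
  assumes "A \<in> positive_stochastic"
  shows "update_step \<eta> A D l \<in> positive_stochastic"
proof -
  have pos: "0 < (\<Sum>k\<in>UNIV. A $ k $ j * exp (\<eta> * D $ k * l $ j))" for j
    using assms by (intro sum_pos) (auto simp: positive_stochastic_def)
  then show ?thesis
    using assms pos[THEN less_imp_neq]
    by (auto simp: positive_stochastic_def update_step_nth[OF assms] simp flip: sum_divide_distrib)
qed

text \<open>The potential \<open>\<Phi>\<close> is minus the cross entropy of \<open>A\<close> relative to \<open>Q\<close>, summed over the columns.\<close>

lemma exp_update_potential:
  fixes A Q :: "real ^ 'n ^ 'n"
  assumes A: "A \<in> positive_stochastic" and Q: "Q \<in> left_stochastic" and l: "l \<in> simplex_set"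
    and D: "\<And>i. \<bar>D $ i\<bar> \<le> b" and "0 < \<eta>" "0 < b"
  defines "\<Phi> \<equiv> \<lambda>A. \<Sum>j\<in>UNIV. \<Sum>i\<in>UNIV. Q $ i $ j * ln (A $ i $ j)"
  shows "\<eta> * (D \<bullet> (Q *v l - A *v l)) \<le> \<Phi> (update_step \<eta> A D l) - \<Phi> A + \<eta>\<^sup>2 * b\<^sup>2 / 2"
proof -
  define Z where "Z j = (\<Sum>k\<in>UNIV. A $ k $ j * exp (\<eta> * D $ k * l $ j))" for j
  define r where "r j = (\<Sum>k\<in>UNIV. A $ k $ j * (\<eta> * D $ k * l $ j))" for j
  have Q': "0 \<le> Q $ i $ j" "(\<Sum>i\<in>UNIV. Q $ i $ j) = 1" for i j
    using Q by (auto simp: left_stochastic_def simplex_set_def column_def)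
  have A': "0 < A $ i $ j" "(\<Sum>i\<in>UNIV. A $ i $ j) = 1" for i j
    using A by (auto simp: positive_stochastic_def)
  have l': "0 \<le> l $ j" "(\<Sum>j\<in>UNIV. l $ j) = 1" for j
    using l by (auto simp: simplex_set_def)
  have Z_pos: "0 < Z j" for j
    unfolding Z_def using A' by (intro sum_pos) auto
  have nonzero: "A $ i $ j \<noteq> 0" "Z j \<noteq> 0" for i j
    using A'(1)[of i j] Z_pos[of j] by auto
  \<comment> \<open>Column \<open>j\<close> sees gains scaled by \<open>l $ j\<close>, so its
    second-order term carries \<open>(l $ j)\<^sup>2 \<le> l $ j\<close>. Summed over the columns
    this costs one \<open>\<eta>\<^sup>2 * b\<^sup>2 / 2\<close> in total instead of one per column.
    The case \<open>l $ j = 0\<close> is separate because \<open>exp_mean_le\<close> asks for a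
    positive range.\<close>
  have lnZ: "ln (Z j) \<le> r j + \<eta>\<^sup>2 * b\<^sup>2 / 2 * l $ j" for j
  proof (cases "l $ j = 0")
    case True
    then show ?thesis using A' by (simp add: Z_def r_def)
  next
    case False
    then have lj: "0 < l $ j" using l'(1)[of j] by simp
    have le1: "l $ j \<le> 1"
      using member_le_sum[of j UNIV "\<lambda>j. l $ j"] l' by simp
    have "Z j \<le> exp (r j + (\<eta> * b * l $ j)\<^sup>2 / 2)"
      unfolding Z_def r_def using A' D lj \<open>0 < \<eta>\<close> \<open>0 < b\<close>
      by (intro exp_mean_le) (auto simp: abs_mult less_imp_le intro!: mult_mono)
    then have "ln (Z j) \<le> r j + (\<eta> * b * l $ j)\<^sup>2 / 2"
      using ln_mono[OF _ Z_pos[of j]] by fastforce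
    also have "(\<eta> * b * l $ j)\<^sup>2 \<le> \<eta>\<^sup>2 * b\<^sup>2 * l $ j"
      using lj le1 by (auto simp: power_mult_distrib power2_eq_square[of "l $ j"] mult_le_cancel_left1 intro!: mult_left_mono)
    finally show ?thesis by simp
  qed
  \<comment> \<open>Taking logarithms makes the update additive, and as each column of
    \<open>Q\<close> sums to 1, every normaliser \<open>Z j\<close> ends up being counted exactly
    once.\<close>
  have "\<Phi> (update_step \<eta> A D l) - \<Phi> A
      = (\<Sum>j\<in>UNIV. \<Sum>i\<in>UNIV. Q $ i $ j * (\<eta> * D $ i * l $ j - ln (Z j)))"
    unfolding \<Phi>_def sum_subtractf[symmetric] right_diff_distrib[symmetric]
    using A' Z_pos
    by (intro sum.cong refl) (simp add: nonzero update_step_nth[OF A] ln_mult ln_div flip: Z_def)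
  also have "\<dots> = (\<Sum>j\<in>UNIV. (\<Sum>i\<in>UNIV. Q $ i $ j * (\<eta> * D $ i * l $ j)) - ln (Z j))"
    by (simp add: right_diff_distrib sum_subtractf Q' flip: sum_distrib_right)
  finally have \<Phi>: "\<Phi> (update_step \<eta> A D l) - \<Phi> A = \<dots>" .
  have inner: "\<eta> * (D \<bullet> (B *v l)) = (\<Sum>j\<in>UNIV. \<Sum>i\<in>UNIV. B $ i $ j * (\<eta> * D $ i * l $ j))"
    for B :: "real ^ 'n ^ 'n"
    by (subst sum.swap)
      (simp add: inner_vec_def matrix_vector_mult_def sum_distrib_left mult_ac)
  have "(\<Sum>j\<in>UNIV. ln (Z j)) \<le> (\<Sum>j\<in>UNIV. r j + \<eta>\<^sup>2 * b\<^sup>2 / 2 * l $ j)"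
    by (intro sum_mono lnZ)
  also have "\<dots> = (\<Sum>j\<in>UNIV. r j) + \<eta>\<^sup>2 * b\<^sup>2 / 2"
    unfolding sum.distrib sum_distrib_left[symmetric] by (simp add: l')
  finally show ?thesis
    unfolding \<Phi> inner_diff_right right_diff_distrib inner by (simp add: sum_subtractf r_def)
qed

text \<open>The potential climbs from its value at the uniform matrix, minus \<open>ln n\<close> for
  each of the n columns, and never exceeds 0; this is the origin of \<open>n * ln n\<close>.
  Stationarity of \<open>l t\<close> is not assumed, so the bound also covers the fictitious
  copy.\<close>

lemma exp_update_regret:
  fixes A :: "nat \<Rightarrow> real ^ 'n ^ 'n" and Q :: "real ^ 'n ^ 'n"
  assumes init: "A 1 = (\<chi> i j. 1 / real CARD('n))"
    and step: "\<And>t. t \<in> {1..T} \<Longrightarrow> A (t + 1) = update_step \<eta> (A t) (D t) (l t)"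
    and l: "\<And>t. t \<in> {1..T} \<Longrightarrow> l t \<in> simplex_set"
    and D: "\<And>t i. t \<in> {1..T} \<Longrightarrow> \<bar>D t $ i\<bar> \<le> b"
    and Q: "Q \<in> left_stochastic" and "0 < \<eta>" "0 < b"
  shows "(\<Sum>t=1..T. D t \<bullet> (Q *v l t - A t *v l t))
    \<le> real CARD('n) * ln (real CARD('n)) / \<eta> + \<eta> * real T * b\<^sup>2 / 2"
proof -
  \<comment> \<open>The value at 0 is unconstrained, so the range starts at 1; it reaches
    \<open>Suc T\<close> because the telescoped sum ends there.\<close>
  have A: "A t \<in> positive_stochastic" if "t \<in> {1..Suc T}" for t
    using that
  proof (induction t)
    case (Suc t)
    show ?case
    proof (cases "t = 0")
      case True
      then show ?thesis using init by (simp add: positive_stochastic_def)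
    next
      case False
      then show ?thesis
        using Suc step[of t] by (auto intro: update_step_positive_stochastic)
    qed
  qed auto
  define \<Phi> where "\<Phi> A = (\<Sum>j\<in>UNIV. \<Sum>i\<in>UNIV. Q $ i $ j * ln (A $ i $ j))" for A :: "real ^ 'n ^ 'n"
  have Q': "0 \<le> Q $ i $ j" "(\<Sum>i\<in>UNIV. Q $ i $ j) = 1" for i j
    using Q by (auto simp: left_stochastic_def simplex_set_def column_def)
  have \<Phi>_last: "\<Phi> (A (Suc T)) \<le> 0"
    unfolding \<Phi>_def
  proof (intro sum_nonpos mult_nonneg_nonpos Q')
    fix i j
    have *: "0 < A (Suc T) $ i $ j" "(\<Sum>i\<in>UNIV. A (Suc T) $ i $ j) = 1" for i j
      using A[of "Suc T"] by (auto simp: positive_stochastic_def)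
    then show "ln (A (Suc T) $ i $ j) \<le> 0"
      using member_le_sum[of i UNIV "\<lambda>i. A (Suc T) $ i $ j"] by (simp add: less_imp_le)
  qed
  have \<Phi>_first: "\<Phi> (A 1) = - (real CARD('n) * ln (real CARD('n)))"
  proof -
    have "\<Phi> (A 1) = (\<Sum>j\<in>(UNIV :: 'n set). (\<Sum>i\<in>UNIV. Q $ i $ j) * ln (1 / real CARD('n)))"
      unfolding \<Phi>_def init sum_distrib_right by simp
    then show ?thesis by (simp add: Q' ln_div)
  qed
  have "\<eta> * (\<Sum>t=1..T. D t \<bullet> (Q *v l t - A t *v l t))
      = (\<Sum>t=1..T. \<eta> * (D t \<bullet> (Q *v l t - A t *v l t)))"
    by (simp add: sum_distrib_left)
  also have "\<dots> \<le> (\<Sum>t=1..T. \<Phi> (A (Suc t)) - \<Phi> (A t) + \<eta>\<^sup>2 * b\<^sup>2 / 2)"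
  proof (rule sum_mono)
    fix t assume t: "t \<in> {1..T}"
    show "\<eta> * (D t \<bullet> (Q *v l t - A t *v l t)) \<le> \<Phi> (A (Suc t)) - \<Phi> (A t) + \<eta>\<^sup>2 * b\<^sup>2 / 2"
      using exp_update_potential[OF A Q l[OF t] D[OF t] \<open>0 < \<eta>\<close> \<open>0 < b\<close>, of t] t step[OF t]
      by (simp add: \<Phi>_def)
  qed
  also have "\<dots> = (\<Sum>t=1..T. \<Phi> (A (Suc t)) - \<Phi> (A t)) + real T * (\<eta>\<^sup>2 * b\<^sup>2 / 2)"
    by (simp add: sum.distrib)
  also have "(\<Sum>t=1..T. \<Phi> (A (Suc t)) - \<Phi> (A t)) = \<Phi> (A (Suc T)) - \<Phi> (A 1)"
    by (rule sum_Suc_diff) simp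
  finally have "\<eta> * (\<Sum>t=1..T. D t \<bullet> (Q *v l t - A t *v l t))
      \<le> real CARD('n) * ln (real CARD('n)) + real T * (\<eta>\<^sup>2 * b\<^sup>2 / 2)"
    using \<Phi>_last \<Phi>_first by linarith
  then have "(\<Sum>t=1..T. D t \<bullet> (Q *v l t - A t *v l t))
      \<le> (real CARD('n) * ln (real CARD('n)) + real T * (\<eta>\<^sup>2 * b\<^sup>2 / 2)) / \<eta>"
    using \<open>0 < \<eta>\<close> by (simp add: field_simps)
  also have "\<dots> = real CARD('n) * ln (real CARD('n)) / \<eta> + \<eta> * real T * b\<^sup>2 / 2"
    using \<open>0 < \<eta>\<close> by (simp add: field_simps power2_eq_square)
  finally show ?thesis .
qed

subsection \<open>Events of high probability and the history\<close>

text \<open>The set where the implication fails need not be an event, so a null event covering it is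
  cut out of the witness.\<close>

lemma with_prob_at_least_AE_mono:
  assumes "prob_space P" "with_prob_at_least P p Q" "AE \<omega> in P. Q \<omega> \<longrightarrow> R \<omega>"
  shows "with_prob_at_least P p R"
proof -
  interpret prob_space P by fact
  obtain E where E: "E \<in> sets P" "p \<le> measure P E" "\<forall>\<omega>\<in>E. Q \<omega>"
    using assms(2) by (auto simp: with_prob_at_least_def)
  obtain N where N: "{\<omega> \<in> space P. \<not> (Q \<omega> \<longrightarrow> R \<omega>)} \<subseteq> N" "N \<in> null_sets P"
    using assms(3) by (auto elim!: AE_E simp: null_sets_def)
  have "measure P (E - N) = measure P E"
    using E N by (simp add: measure_Diff_null_set)
  moreover have "\<forall>\<omega>\<in>E - N. R \<omega>"
    using E N sets.sets_into_space[OF E(1)] by blast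
  ultimately show ?thesis
    using E N by (auto simp: with_prob_at_least_def intro!: bexI[of _ "E - N"])
qed

lemma with_prob_at_least_AE:
  assumes "prob_space P" "p \<le> 1" "AE \<omega> in P. R \<omega>"
  shows "with_prob_at_least P p R"
proof (rule with_prob_at_least_AE_mono[OF assms(1)])
  show "with_prob_at_least P p (\<lambda>_. True)"
    using assms prob_space.prob_space[OF assms(1)]
    by (auto simp: with_prob_at_least_def intro!: bexI[of _ "space P"])
qed (use assms in auto)

lemma with_prob_at_least_conj:
  assumes "prob_space P" "with_prob_at_least P (1 - a) Q" "with_prob_at_least P (1 - b) R"
  shows "with_prob_at_least P (1 - (a + b)) (\<lambda>\<omega>. Q \<omega> \<and> R \<omega>)"
proof -
  interpret prob_space P by fact
  obtain E where E: "E \<in> sets P" "1 - a \<le> measure P E" "\<forall>\<omega>\<in>E. Q \<omega>"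
    using assms(2) by (auto simp: with_prob_at_least_def)
  obtain E' where E': "E' \<in> sets P" "1 - b \<le> measure P E'" "\<forall>\<omega>\<in>E'. R \<omega>"
    using assms(3) by (auto simp: with_prob_at_least_def)
  have "measure P E + measure P E' = measure P (E \<union> E') + measure P (E \<inter> E')"
    using E E' by (simp add: measure_Un3 fmeasurable_eq_sets)
  then have "1 - (a + b) \<le> measure P (E \<inter> E')"
    using E E' prob_le_1[of "E \<union> E'"] by linarith
  then show ?thesis
    using E E' by (auto simp: with_prob_at_least_def intro!: bexI[of _ "E \<inter> E'"])
qed

text \<open>\<open>\<omega> \<in> space P\<close> is carried along because the run is only described
  there.\<close>

lemma with_prob_at_least_not_greater:
  assumes "prob_space P" "S \<in> borel_measurable P"
    and "measure P {\<omega> \<in> space P. \<epsilon> < S \<omega>} \<le> \<delta>"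
  shows "with_prob_at_least P (1 - \<delta>) (\<lambda>\<omega>. \<omega> \<in> space P \<and> S \<omega> \<le> (\<epsilon> :: real))"
proof -
  interpret prob_space P by fact
  note [measurable] = assms(2)
  have "{\<omega> \<in> space P. \<epsilon> < S \<omega>} \<in> sets P" by measurable
  from prob_compl[OF this] have "1 - \<delta> \<le> measure P (space P - {\<omega> \<in> space P. \<epsilon> < S \<omega>})"
    using assms(3) by simp
  then show ?thesis
    unfolding with_prob_at_least_def
    by (intro bexI[of _ "space P - {\<omega> \<in> space P. \<epsilon> < S \<omega>}"]) auto
qed

context
  fixes P :: "'w measure" and \<theta> :: "nat \<Rightarrow> 'w \<Rightarrow> real ^ 'd" and l :: "nat \<Rightarrow> 'w \<Rightarrow> real ^ 'n"
    and D_sub :: "nat \<Rightarrow> 'w \<Rightarrow> real ^ 'd" and D_grad :: "nat \<Rightarrow> 'w \<Rightarrow> real ^ 'n"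
begin

lemma space_history [simp]: "space (history P \<theta> l D_sub D_grad t) = space P"
  by (simp add: history_def space_measure_of_conv)

lemma sets_history: "sets (history P \<theta> l D_sub D_grad t) = sigma_sets (space P)
     ({\<theta> s -` A \<inter> space P | s A. s \<in> {1..t} \<and> A \<in> sets borel} \<union>
      {l s -` A \<inter> space P | s A. s \<in> {1..t} \<and> A \<in> sets borel} \<union>
      {D_sub s -` A \<inter> space P | s A. s \<in> {1..<t} \<and> A \<in> sets borel} \<union>
      {D_grad s -` A \<inter> space P | s A. s \<in> {1..<t} \<and> A \<in> sets borel})"
  unfolding history_def by (rule sets_measure_of) auto

lemma measurable_history:
  shows "s \<in> {1..t} \<Longrightarrow> \<theta> s \<in> borel_measurable (history P \<theta> l D_sub D_grad t)"
    and "s \<in> {1..t} \<Longrightarrow> l s \<in> borel_measurable (history P \<theta> l D_sub D_grad t)"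
    and "s \<in> {1..<t} \<Longrightarrow> D_sub s \<in> borel_measurable (history P \<theta> l D_sub D_grad t)"
    and "s \<in> {1..<t} \<Longrightarrow> D_grad s \<in> borel_measurable (history P \<theta> l D_sub D_grad t)"
proof -
  show "\<theta> s \<in> borel_measurable (history P \<theta> l D_sub D_grad t)" if "s \<in> {1..t}"
    by (insert that, rule measurableI, simp, unfold sets_history space_history, rule sigma_sets.Basic,
        rule UnI1, rule UnI1, rule UnI1, rule CollectI, intro exI, rule conjI, rule refl, simp)
  show "l s \<in> borel_measurable (history P \<theta> l D_sub D_grad t)" if "s \<in> {1..t}"
    by (insert that, rule measurableI, simp, unfold sets_history space_history, rule sigma_sets.Basic,
        rule UnI1, rule UnI1, rule UnI2, rule CollectI, intro exI, rule conjI, rule refl, simp)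
  show "D_sub s \<in> borel_measurable (history P \<theta> l D_sub D_grad t)" if "s \<in> {1..<t}"
    by (insert that, rule measurableI, simp, unfold sets_history space_history, rule sigma_sets.Basic,
        rule UnI1, rule UnI2, rule CollectI, intro exI, rule conjI, rule refl, simp)
  show "D_grad s \<in> borel_measurable (history P \<theta> l D_sub D_grad t)" if "s \<in> {1..<t}"
    by (insert that, rule measurableI, simp, unfold sets_history space_history, rule sigma_sets.Basic,
        rule UnI2, rule CollectI, intro exI, rule conjI, rule refl, simp)
qed

lemma subalgebra_history_mono:
  assumes "s \<le> t"
  shows "subalgebra (history P \<theta> l D_sub D_grad t) (history P \<theta> l D_sub D_grad s)"
proof -
  have "sets (history P \<theta> l D_sub D_grad s) \<subseteq> sets (history P \<theta> l D_sub D_grad t)"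
  proof -
    have "{1..s} \<subseteq> {1..t}" "{1..<s} \<subseteq> {1..<t}" using assms by auto
    then show ?thesis
      unfolding sets_history by (intro sigma_sets_mono' Un_mono; blast)
  qed
  then show ?thesis by (simp add: subalgebra_def)
qed

lemma subalgebra_history:
  assumes "\<And>s. s \<in> {1..t} \<Longrightarrow> \<theta> s \<in> borel_measurable P"
    and "\<And>s. s \<in> {1..t} \<Longrightarrow> l s \<in> borel_measurable P"
    and "\<And>s. s \<in> {1..<t} \<Longrightarrow> D_sub s \<in> borel_measurable P"
    and "\<And>s. s \<in> {1..<t} \<Longrightarrow> D_grad s \<in> borel_measurable P"
  shows "subalgebra P (history P \<theta> l D_sub D_grad t)"
proof -
  have "sets (history P \<theta> l D_sub D_grad t) \<subseteq> sets P"
    unfolding sets_history using assms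
    by (intro sets.sigma_sets_subset) (auto intro: measurable_sets)
  then show ?thesis by (simp add: subalgebra_def)
qed

end

subsection \<open>Regret against stochastic gradients\<close>

text \<open>Rounds are numbered from 1, so \<open>s\<close> is the value at 1, and the value at 0 is junk.\<close>

primrec iterate_from :: "'s \<Rightarrow> (nat \<Rightarrow> 's \<Rightarrow> 's) \<Rightarrow> nat \<Rightarrow> 's" where
  "iterate_from s step 0 = s"
| "iterate_from s step (Suc t) = (if t = 0 then s else step t (iterate_from s step t))"

section \<open>Norm duality on the simplex and stochastic matrices\<close>

lemma inner_le_l1_norm:
  assumes "\<And>i. \<bar>x $ i\<bar> \<le> b"
  shows "\<bar>u \<bullet> x\<bar> \<le> l1_norm u * b"
  unfolding inner_vec_def l1_norm_def sum_distrib_right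
  by (rule order_trans[OF sum_abs]) (auto simp: abs_mult intro!: sum_mono mult_left_mono assms)

lemma l1_norm_simplex_diff_le:
  assumes "u \<in> simplex_set" "v \<in> simplex_set"
  shows "l1_norm (u - v) \<le> 2"
proof -
  have "l1_norm (u - v) \<le> (\<Sum>i\<in>UNIV. u $ i + v $ i)"
    unfolding l1_norm_def using assms
    by (intro sum_mono) (simp add: simplex_set_def abs_le_iff)
  also have "\<dots> = 2"
    using assms by (simp add: simplex_set_def sum.distrib)
  finally show ?thesis .
qed

lemma left_stochastic_mult_simplex:
  assumes "A \<in> left_stochastic" "l \<in> simplex_set"
  shows "A *v l \<in> simplex_set"
proof -
  have A: "0 \<le> A $ i $ j" "(\<Sum>i\<in>UNIV. A $ i $ j) = 1" for i j
    using assms by (auto simp: left_stochastic_def simplex_set_def column_def)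
  have "(\<Sum>i\<in>UNIV. \<Sum>j\<in>UNIV. A $ i $ j * l $ j) = (\<Sum>j\<in>UNIV. (\<Sum>i\<in>UNIV. A $ i $ j) * l $ j)"
    by (subst sum.swap) (simp add: sum_distrib_right)
  then show ?thesis
    using A assms(2) by (auto simp: simplex_set_def matrix_vector_mult_def intro!: sum_nonneg)
qed

lemma positive_stochastic_left_stochastic:
  "A \<in> positive_stochastic \<Longrightarrow> A \<in> left_stochastic"
  by (auto simp: positive_stochastic_def left_stochastic_def simplex_set_def column_def less_imp_le)

lemma uniform_positive_stochastic:
  "(\<chi> i j. 1 / real CARD('n)) \<in> (positive_stochastic :: (real ^ 'n ^ 'n) set)"
  by (simp add: positive_stochastic_def)

lemma sqrt_8: "sqrt 8 = 2 * sqrt 2"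
  using real_sqrt_mult[of 4 2] by simp

text \<open>Origin of the constants, in units of \<open>B * D * sqrt (real T)\<close>: the actual
  descent with the prescribed step costs \<open>sqrt 2 / 2 + sqrt 2 / 4\<close>; the copy, with its
  optimal step, costs 1 for the start distance and 1 for the squared norms; Azuma with range
  \<open>2 * B * D\<close> adds \<open>sqrt (8 * ln (1 / \<delta>))\<close>.\<close>

lemma stochastic_subgradient_regret:
  fixes P :: "'w measure" and \<Theta> :: "(real ^ 'd) set" and F :: "nat \<Rightarrow> 'w measure" and X \<theta> :: "nat \<Rightarrow> 'w \<Rightarrow> real ^ 'd"
  defines "G \<equiv> \<lambda>t. vec_cond_exp P (F t) (X t)"
  assumes P: "prob_space P"
    and sub: "\<And>t. t \<in> {1..T} \<Longrightarrow> subalgebra P (F t)"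
    and filt: "\<And>s t. 1 \<le> s \<Longrightarrow> s < t \<Longrightarrow> t \<le> T \<Longrightarrow> subalgebra (F t) (F s)"
    and X: "\<And>t. t \<in> {1..T} \<Longrightarrow> X t \<in> borel_measurable P"
    and adapted: "\<And>s t. 1 \<le> s \<Longrightarrow> s < t \<Longrightarrow> t \<le> T \<Longrightarrow> X s \<in> borel_measurable (F t)"
    and \<theta>: "\<And>t. t \<in> {1..T} \<Longrightarrow> \<theta> t \<in> borel_measurable (F t)"
    and X_bound: "\<And>t. t \<in> {1..T} \<Longrightarrow> AE \<omega> in P. norm (X t \<omega>) \<le> D"
    and \<Theta>: "closed \<Theta>" "convex \<Theta>" "0 \<in> \<Theta>" "\<And>x. x \<in> \<Theta> \<Longrightarrow> norm x \<le> B"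
    and init: "\<And>\<omega>. \<omega> \<in> space P \<Longrightarrow> \<theta> 1 \<omega> = 0"
    and step: "\<And>\<omega> t. \<omega> \<in> space P \<Longrightarrow> t \<in> {1..T} \<Longrightarrow>
      \<theta> (t + 1) \<omega> = closest_point \<Theta> (\<theta> t \<omega> - (B / (D * sqrt (2 * real T))) *\<^sub>R X t \<omega>)"
    and T: "1 \<le> T" and \<delta>: "0 < \<delta>" "\<delta> < 1"
  shows "with_prob_at_least P (1 - \<delta>) (\<lambda>\<omega>. \<forall>x\<in>\<Theta>. (\<Sum>t=1..T. G t \<omega> \<bullet> (\<theta> t \<omega> - x))
    \<le> B * D * sqrt (real T) * (3 / 4 * sqrt 2 + 2 + sqrt (8 * ln (1 / \<delta>))))"
proof -
  interpret prob_space P by fact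
  have X_bounds: "AE \<omega> in P. \<forall>t\<in>{1..T}. norm (X t \<omega>) \<le> D"
    using X_bound by (intro AE_finite_allI) auto
  have G_bounds: "AE \<omega> in P. \<forall>t\<in>{1..T}. norm (G t \<omega>) \<le> D"
    unfolding G_def using X_bound
    by (intro AE_finite_allI norm_vec_cond_exp_le P sub X) auto
  \<comment> \<open>A claim free of \<open>\<omega>\<close> that holds almost surely holds outright,
    since \<open>P\<close> is a probability measure. A round to read it off exists because
    \<open>1 \<le> T\<close>.\<close>
  have "AE \<omega> in P. 0 \<le> D"
  proof -
    have "AE \<omega> in P. norm (X 1 \<omega>) \<le> D" using X_bound T by simp
    then show ?thesis by eventually_elim (rule order_trans[OF norm_ge_zero])
  qed
  then have "0 \<le> D" by simp
  have "0 \<le> B" using \<Theta>(4)[OF \<Theta>(3)] by simp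
  have \<theta>_in: "\<theta> t \<omega> \<in> \<Theta>" if "\<omega> \<in> space P" "t \<in> {1..T}" for t \<omega>
  proof (cases "t = 1")
    case False
    then have "t - 1 \<in> {1..T}" using that by auto
    from step[OF that(1) this] show ?thesis
      using False that \<Theta> closest_point_in_set[of \<Theta>] by auto
  qed (use that init \<Theta> in auto)
  have diff_bound: "norm (x - y) \<le> 2 * B" if "x \<in> \<Theta>" "y \<in> \<Theta>" for x y
    using norm_triangle_ineq4[of x y] \<Theta>(4)[OF that(1)] \<Theta>(4)[OF that(2)] by linarith
  \<comment> \<open>If \<open>B\<close> or \<open>D\<close> is 0, the step size is 0 (division by 0
    gives 0) and the regret bound, which asks for a positive step, does not apply; but then every
    summand is already nonpositive.\<close>
  show ?thesis
  proof (cases "B = 0 \<or> D = 0")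
    case True
    have "AE \<omega> in P. \<forall>x\<in>\<Theta>. (\<Sum>t=1..T. G t \<omega> \<bullet> (\<theta> t \<omega> - x)) \<le> 0"
      using G_bounds AE_space
    proof eventually_elim
      case (elim \<omega>)
      show ?case
      proof (intro ballI sum_nonpos)
        fix x t assume x: "x \<in> \<Theta>" and t: "t \<in> {1..T}"
        have "G t \<omega> \<bullet> (\<theta> t \<omega> - x) \<le> norm (G t \<omega>) * norm (\<theta> t \<omega> - x)"
          by (rule norm_cauchy_schwarz)
        also have "\<dots> \<le> D * (2 * B)"
          using elim t x \<open>0 \<le> D\<close> by (intro mult_mono diff_bound \<theta>_in) auto
        finally show "G t \<omega> \<bullet> (\<theta> t \<omega> - x) \<le> 0" using True by auto
      qed
    qed
    then show ?thesis
      using True \<delta> by (intro with_prob_at_least_AE[OF P]) auto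
  next
    case False
    then have "0 < B" "0 < D" using \<open>0 \<le> B\<close> \<open>0 \<le> D\<close> by auto
    define N where "N t \<omega> = G t \<omega> - X t \<omega>" for t \<omega>
    \<comment> \<open>Balances the two terms of \<open>projected_gradient_regret\<close> for start
      distance \<open>B\<close> and vectors of norm up to \<open>2 * D\<close>, the size of the
      noise.\<close>
    define \<eta> where "\<eta> = B / (2 * D * sqrt (real T))"
    define y where "y t \<omega> = iterate_from 0 (\<lambda>t x. closest_point \<Theta> (x - \<eta> *\<^sub>R N t \<omega>)) t" for t \<omega>
    have y_init: "y 1 \<omega> = 0" and y_step: "1 \<le> t \<Longrightarrow> y (t + 1) \<omega> = closest_point \<Theta> (y t \<omega> - \<eta> *\<^sub>R N t \<omega>)"
      for t \<omega> by (auto simp: y_def)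
    have y_in: "y t \<omega> \<in> \<Theta>" for t \<omega>
      unfolding y_def using \<Theta> by (cases t) (auto intro: closest_point_in_set)
    have G_F: "G t \<in> borel_measurable (F t)" for t
      by (simp add: G_def)
    \<comment> \<open>Predictability: \<open>y (Suc t)\<close> uses \<open>N t = G t - X t\<close>,
      where \<open>G t\<close> is already known to \<open>F t\<close> and \<open>X t\<close> is
      known to \<open>F (Suc t)\<close>; projection is continuous.\<close>
    have y_F: "y t \<in> borel_measurable (F t)" if "t \<in> {1..T}" for t
      using that
    proof (induction t)
      case (Suc t)
      show ?case
      proof (cases "t = 0")
        case True
        then show ?thesis by (simp add: y_def)
      next
        case False
        then have t: "1 \<le> t" "t < Suc t" "Suc t \<le> T" using Suc.prems by auto
        have "y t \<in> borel_measurable (F (Suc t))"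
          using Suc t by (intro measurable_from_subalg[OF filt[OF t]]) auto
        moreover have "N t \<in> borel_measurable (F (Suc t))"
          unfolding N_def using measurable_from_subalg[OF filt[OF t] G_F] adapted[OF t] by measurable
        ultimately have "(\<lambda>\<omega>. y t \<omega> - \<eta> *\<^sub>R N t \<omega>) \<in> borel_measurable (F (Suc t))"
          by measurable
        then have "(\<lambda>\<omega>. closest_point \<Theta> (y t \<omega> - \<eta> *\<^sub>R N t \<omega>)) \<in> borel_measurable (F (Suc t))"
          using \<Theta> by (intro borel_measurable_continuous_on[OF continuous_on_closest_point]) auto
        then show ?thesis using y_step[OF t(1)] by simp
      qed
    qed auto
    define Z where "Z t \<omega> = \<theta> t \<omega> - y t \<omega>" for t \<omega>
    have Z_F: "Z t \<in> borel_measurable (F t)" if "t \<in> {1..T}" for t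
      unfolding Z_def using \<theta>[OF that] y_F[OF that] by measurable
    have Z_bound: "AE \<omega> in P. norm (Z t \<omega>) \<le> 2 * B" if "t \<in> {1..T}" for t
      using AE_space by eventually_elim (auto simp: Z_def intro!: diff_bound \<theta>_in y_in that)
    \<comment> \<open>Azuma is fed with the pairing against \<open>X t\<close>; against
      \<open>N t\<close> the same estimate would give \<open>4 * B * D\<close>.\<close>
    have ZX_bound: "AE \<omega> in P. \<bar>Z t \<omega> \<bullet> X t \<omega>\<bar> \<le> 2 * B * D" if "t \<in> {1..T}" for t
      using Z_bound[OF that] X_bound[OF that]
    proof eventually_elim
      case (elim \<omega>)
      have "\<bar>Z t \<omega> \<bullet> X t \<omega>\<bar> \<le> norm (Z t \<omega>) * norm (X t \<omega>)" by (rule Cauchy_Schwarz_ineq2)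
      also have "\<dots> \<le> 2 * B * D" using elim \<open>0 < B\<close> by (intro mult_mono) auto
      finally show ?case .
    qed
    have "measure P {\<omega> \<in> space P. 2 * B * D * sqrt (2 * real T * ln (1 / \<delta>))
        < (\<Sum>t=1..T. Z t \<omega> \<bullet> (vec_cond_exp P (F t) (X t) \<omega> - X t \<omega>))} \<le> \<delta>"
      by (rule azuma_hoeffding_inner[OF P sub filt X adapted Z_F X_bound Z_bound ZX_bound])
        (use \<open>0 < B\<close> \<open>0 < D\<close> T \<delta> in auto)
    moreover have "(\<lambda>\<omega>. \<Sum>t=1..T. Z t \<omega> \<bullet> N t \<omega>) \<in> borel_measurable P"
      unfolding N_def using X measurable_from_subalg[OF sub Z_F] measurable_from_subalg[OF sub G_F]
      by (intro borel_measurable_sum borel_measurable_inner borel_measurable_diff) auto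
    ultimately have "with_prob_at_least P (1 - \<delta>) (\<lambda>\<omega>. \<omega> \<in> space P \<and>
        (\<Sum>t=1..T. Z t \<omega> \<bullet> N t \<omega>) \<le> 2 * B * D * sqrt (2 * real T * ln (1 / \<delta>)))"
      by (intro with_prob_at_least_not_greater[OF P]) (auto simp: N_def G_def)
    then show ?thesis
    proof (rule with_prob_at_least_AE_mono[OF P])
      show "AE \<omega> in P. \<omega> \<in> space P \<and>
          (\<Sum>t=1..T. Z t \<omega> \<bullet> N t \<omega>) \<le> 2 * B * D * sqrt (2 * real T * ln (1 / \<delta>)) \<longrightarrow>
        (\<forall>x\<in>\<Theta>. (\<Sum>t=1..T. G t \<omega> \<bullet> (\<theta> t \<omega> - x))
          \<le> B * D * sqrt (real T) * (3 / 4 * sqrt 2 + 2 + sqrt (8 * ln (1 / \<delta>))))"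
        using X_bounds G_bounds
      proof eventually_elim
        case (elim \<omega>)
        show ?case
        proof (intro impI ballI, elim conjE)
          fix x assume x: "x \<in> \<Theta>" and \<omega>: "\<omega> \<in> space P"
            and mart: "(\<Sum>t=1..T. Z t \<omega> \<bullet> N t \<omega>) \<le> 2 * B * D * sqrt (2 * real T * ln (1 / \<delta>))"
          have Bx: "(norm (0 - x))\<^sup>2 \<le> B\<^sup>2"
            using \<Theta>(4)[OF x] by (intro power_mono) auto
          have regret: "(\<Sum>t=1..T. X t \<omega> \<bullet> (\<theta> t \<omega> - x)) \<le> 3 / 4 * sqrt 2 * (B * D * sqrt (real T))"
          proof -
            define \<beta> where "\<beta> = B / (D * sqrt (2 * real T))"
            have "0 < \<beta>" using \<open>0 < B\<close> \<open>0 < D\<close> T by (simp add: \<beta>_def)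
            have "(\<Sum>t=1..T. X t \<omega> \<bullet> (\<theta> t \<omega> - x)) \<le> (norm (\<theta> 1 \<omega> - x))\<^sup>2 / (2 * \<beta>) + \<beta> * real T * D\<^sup>2 / 2"
              using elim step[OF \<omega>] x \<Theta> \<open>0 < \<beta>\<close>
              by (intro projected_gradient_regret) (auto simp: \<beta>_def)
            also have "\<dots> \<le> B\<^sup>2 / (2 * \<beta>) + \<beta> * real T * D\<^sup>2 / 2"
              using Bx init[OF \<omega>] \<open>0 < \<beta>\<close> by (auto intro!: divide_right_mono)
            also have "\<dots> = 3 / 4 * sqrt 2 * (B * D * sqrt (real T))"
              using \<open>0 < B\<close> \<open>0 < D\<close> T
              by (simp add: \<beta>_def real_sqrt_mult field_simps power2_eq_square)
            finally show ?thesis .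
          qed
          have aux: "(\<Sum>t=1..T. N t \<omega> \<bullet> (y t \<omega> - x)) \<le> 2 * (B * D * sqrt (real T))"
          proof -
            have "0 < \<eta>" using \<open>0 < B\<close> \<open>0 < D\<close> T by (simp add: \<eta>_def)
            have N_bound: "norm (N t \<omega>) \<le> 2 * D" if "t \<in> {1..T}" for t
              using elim that norm_triangle_ineq4[of "G t \<omega>" "X t \<omega>"] by (force simp: N_def)
            have "(\<Sum>t=1..T. N t \<omega> \<bullet> (y t \<omega> - x)) \<le> (norm (y 1 \<omega> - x))\<^sup>2 / (2 * \<eta>) + \<eta> * real T * (2 * D)\<^sup>2 / 2"
              using N_bound x \<Theta> \<open>0 < \<eta>\<close> y_step by (intro projected_gradient_regret) auto
            also have "\<dots> \<le> B\<^sup>2 / (2 * \<eta>) + \<eta> * real T * (2 * D)\<^sup>2 / 2"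
              using Bx y_init \<open>0 < \<eta>\<close> by (auto intro!: divide_right_mono)
            also have "\<dots> = 2 * (B * D * sqrt (real T))"
              using \<open>0 < B\<close> \<open>0 < D\<close> T by (simp add: \<eta>_def field_simps power2_eq_square)
            finally show ?thesis .
          qed
          have split: "(\<Sum>t=1..T. G t \<omega> \<bullet> (\<theta> t \<omega> - x)) = (\<Sum>t=1..T. X t \<omega> \<bullet> (\<theta> t \<omega> - x))
              + (\<Sum>t=1..T. N t \<omega> \<bullet> (y t \<omega> - x)) + (\<Sum>t=1..T. Z t \<omega> \<bullet> N t \<omega>)"
            unfolding sum.distrib[symmetric]
            by (intro sum.cong refl)
              (simp add: N_def Z_def inner_diff_left inner_diff_right inner_commute algebra_simps)
          have "2 * B * D * sqrt (2 * real T * ln (1 / \<delta>))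
              = B * D * sqrt (real T) * sqrt (8 * ln (1 / \<delta>))"
            by (simp add: real_sqrt_mult sqrt_8)
          moreover have "B * D * sqrt (real T) * (3 / 4 * sqrt 2 + 2 + sqrt (8 * ln (1 / \<delta>)))
              = 3 / 4 * sqrt 2 * (B * D * sqrt (real T)) + 2 * (B * D * sqrt (real T))
                + B * D * sqrt (real T) * sqrt (8 * ln (1 / \<delta>))"
            by (simp add: distrib_left)
          ultimately show "(\<Sum>t=1..T. G t \<omega> \<bullet> (\<theta> t \<omega> - x))
              \<le> B * D * sqrt (real T) * (3 / 4 * sqrt 2 + 2 + sqrt (8 * ln (1 / \<delta>)))"
            unfolding split using regret aux mart by linarith
        qed
      qed
    qed
  qed
qed

text \<open>Origin of the constants, in units of \<open>b * sqrt (real T)\<close>: the actual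
  learner costs \<open>sqrt K + sqrt K / 2\<close> with its prescribed step; the copy, with the
  optimal step for noise entries up to \<open>2 * b\<close>, costs \<open>sqrt 2 * sqrt K\<close>
  twice. Azuma has range \<open>2 * b\<close>, because \<open>R t *v l t\<close> and
  \<open>l t\<close> are points of the simplex, at l1 distance at most 2. The sign of
  \<open>b\<close> is exported for the final rescaling.\<close>

lemma stochastic_multiplier_regret:
  fixes P :: "'w measure" and F :: "nat \<Rightarrow> 'w measure" and X l :: "nat \<Rightarrow> 'w \<Rightarrow> real ^ 'n"
    and M :: "nat \<Rightarrow> 'w \<Rightarrow> real ^ 'n ^ 'n"
  defines "G \<equiv> \<lambda>t. vec_cond_exp P (F t) (X t)"
    and "K \<equiv> real CARD('n) * ln (real CARD('n))"
  assumes P: "prob_space P"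
    and sub: "\<And>t. t \<in> {1..T} \<Longrightarrow> subalgebra P (F t)"
    and filt: "\<And>s t. 1 \<le> s \<Longrightarrow> s < t \<Longrightarrow> t \<le> T \<Longrightarrow> subalgebra (F t) (F s)"
    and X: "\<And>t. t \<in> {1..T} \<Longrightarrow> X t \<in> borel_measurable P"
    and adapted: "\<And>s t. 1 \<le> s \<Longrightarrow> s < t \<Longrightarrow> t \<le> T \<Longrightarrow> X s \<in> borel_measurable (F t)"
    and l: "\<And>t. t \<in> {1..T} \<Longrightarrow> l t \<in> borel_measurable (F t)"
    and X_bound: "\<And>t. t \<in> {1..T} \<Longrightarrow> AE \<omega> in P. infnorm (X t \<omega>) \<le> b"
    and init: "\<And>\<omega>. \<omega> \<in> space P \<Longrightarrow> M 1 \<omega> = (\<chi> i j. 1 / real CARD('n))"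
    and step: "\<And>\<omega> t. \<omega> \<in> space P \<Longrightarrow> t \<in> {1..T} \<Longrightarrow>
      M (t + 1) \<omega> = update_step (sqrt (K / (real T * b\<^sup>2))) (M t \<omega>) (X t \<omega>) (l t \<omega>)"
    and l_simplex: "\<And>\<omega> t. \<omega> \<in> space P \<Longrightarrow> t \<in> {1..T} \<Longrightarrow> l t \<omega> \<in> simplex_set"
    and stationary: "\<And>\<omega> t. \<omega> \<in> space P \<Longrightarrow> t \<in> {1..T} \<Longrightarrow> M t \<omega> *v l t \<omega> = l t \<omega>"
    and n: "2 \<le> CARD('n)" and T: "1 \<le> T" and \<delta>: "0 < \<delta>" "\<delta> < 1"
  shows "with_prob_at_least P (1 - \<delta>) (\<lambda>\<omega>. \<forall>A\<in>left_stochastic.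
    (\<Sum>t=1..T. G t \<omega> \<bullet> (A *v l t \<omega> - l t \<omega>))
    \<le> b * sqrt (real T) * ((3 / 2 + 2 * sqrt 2) * sqrt K + sqrt (8 * ln (1 / \<delta>))))"
    and "0 \<le> b"
proof -
  interpret prob_space P by fact
  have X_nth: "AE \<omega> in P. \<bar>X t \<omega> $ i\<bar> \<le> b" if "t \<in> {1..T}" for t i
    using X_bound[OF that] by eventually_elim (rule order_trans[OF component_le_infnorm_cart])
  have X_bounds: "AE \<omega> in P. \<forall>t\<in>{1..T}. \<forall>i. \<bar>X t \<omega> $ i\<bar> \<le> b"
    using X_nth by (intro AE_finite_allI) (auto simp: AE_all_countable)
  have G_bounds: "AE \<omega> in P. \<forall>t\<in>{1..T}. \<forall>i. \<bar>G t \<omega> $ i\<bar> \<le> b"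
    unfolding G_def using abs_vec_cond_exp_nth_le[OF P sub X X_nth]
    by (intro AE_finite_allI) (auto simp: AE_all_countable)
  have "AE \<omega> in P. 0 \<le> b"
  proof -
    have "AE \<omega> in P. infnorm (X 1 \<omega>) \<le> b" using X_bound T by simp
    then show ?thesis by eventually_elim (rule order_trans[OF infnorm_pos_le])
  qed
  then show "0 \<le> b" by simp
  have "0 < K" using n by (simp add: K_def)
  show "with_prob_at_least P (1 - \<delta>) (\<lambda>\<omega>. \<forall>A\<in>left_stochastic.
    (\<Sum>t=1..T. G t \<omega> \<bullet> (A *v l t \<omega> - l t \<omega>))
    \<le> b * sqrt (real T) * ((3 / 2 + 2 * sqrt 2) * sqrt K + sqrt (8 * ln (1 / \<delta>))))"
  \<comment> \<open>For \<open>b = 0\<close> the prescribed step size degenerates to 0, but the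
    conditional means then vanish as well.\<close>
  proof (cases "b = 0")
    case True
    have "AE \<omega> in P. \<forall>A\<in>left_stochastic. (\<Sum>t=1..T. G t \<omega> \<bullet> (A *v l t \<omega> - l t \<omega>)) \<le> 0"
      using G_bounds
    proof eventually_elim
      case (elim \<omega>)
      have "G t \<omega> = 0" if "t \<in> {1..T}" for t
        using elim that True by (auto simp: vec_eq_iff)
      then show ?case by simp
    qed
    then show ?thesis
      using True \<delta> by (intro with_prob_at_least_AE[OF P]) auto
  next
    case False
    then have "0 < b" using \<open>0 \<le> b\<close> by auto
    define N where "N t \<omega> = G t \<omega> - X t \<omega>" for t \<omega>
    define \<eta> where "\<eta> = sqrt K / (b * sqrt (2 * real T))"
    define U :: "real ^ 'n ^ 'n" where "U = (\<chi> i j. 1 / real CARD('n))"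
    define R where "R t \<omega> = iterate_from U (\<lambda>t A. update_step \<eta> A (N t \<omega>) (l t \<omega>)) t" for t \<omega>
    have R_init: "R 1 \<omega> = U" and R_step: "1 \<le> t \<Longrightarrow> R (t + 1) \<omega> = update_step \<eta> (R t \<omega>) (N t \<omega>) (l t \<omega>)"
      for t \<omega> by (auto simp: R_def)
    \<comment> \<open>Holds for every \<open>\<omega>\<close>, however large the noise, so the
      explicit quotient of \<open>update_step_nth\<close> is available for measurability.\<close>
    have R_pos: "R t \<omega> \<in> positive_stochastic" for t \<omega>
    proof (induction t)
      case (Suc t)
      then show ?case
        by (auto simp: R_def U_def uniform_positive_stochastic intro: update_step_positive_stochastic)
    qed (simp add: R_def U_def uniform_positive_stochastic)
    have G_F: "G t \<in> borel_measurable (F t)" for t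
      by (simp add: G_def)
    have R_F: "(\<lambda>\<omega>. R t \<omega> $ i $ j) \<in> borel_measurable (F t)" if "t \<in> {1..T}" for t i j
      using that
    proof (induction t arbitrary: i j)
      case (Suc t)
      show ?case
      proof (cases "t = 0")
        case True
        then show ?thesis by (simp add: R_def)
      next
        case False
        then have t: "1 \<le> t" "t < Suc t" "Suc t \<le> T" using Suc.prems by auto
        have [measurable]: "(\<lambda>\<omega>. R t \<omega> $ i $ j) \<in> borel_measurable (F (Suc t))" for i j
          using Suc t by (intro measurable_from_subalg[OF filt[OF t]]) auto
        have "N t \<in> borel_measurable (F (Suc t))"
          unfolding N_def using measurable_from_subalg[OF filt[OF t] G_F] adapted[OF t] by measurable
        then have [measurable]: "(\<lambda>\<omega>. N t \<omega> $ i) \<in> borel_measurable (F (Suc t))" for i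
          by (simp add: borel_measurable_vec_iff)
        have "l t \<in> borel_measurable (F (Suc t))"
          using t by (intro measurable_from_subalg[OF filt[OF t] l]) auto
        then have [measurable]: "(\<lambda>\<omega>. l t \<omega> $ i) \<in> borel_measurable (F (Suc t))" for i
          by (simp add: borel_measurable_vec_iff)
        show ?thesis
          using False R_step[of t] by (simp add: update_step_nth[OF R_pos])
      qed
    qed auto
    define Z where "Z t \<omega> = R t \<omega> *v l t \<omega> - l t \<omega>" for t \<omega>
    have Z_F: "Z t \<in> borel_measurable (F t)" if "t \<in> {1..T}" for t
    proof -
      have [measurable]: "(\<lambda>\<omega>. l t \<omega> $ i) \<in> borel_measurable (F t)" for i
        using l[OF that] by (simp add: borel_measurable_vec_iff)
      note [measurable] = R_F[OF that]
      show ?thesis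
        unfolding borel_measurable_vec_iff Z_def by (simp add: matrix_vector_mult_def)
    qed
    have Z_l1: "l1_norm (Z t \<omega>) \<le> 2" if "\<omega> \<in> space P" "t \<in> {1..T}" for t \<omega>
      unfolding Z_def
      by (intro l1_norm_simplex_diff_le left_stochastic_mult_simplex l_simplex that
          positive_stochastic_left_stochastic R_pos)
    have Z_bound: "AE \<omega> in P. norm (Z t \<omega>) \<le> 2" if "t \<in> {1..T}" for t
      using AE_space
    proof eventually_elim
      case (elim \<omega>)
      have "norm (Z t \<omega>) \<le> l1_norm (Z t \<omega>)" unfolding l1_norm_def by (rule norm_le_l1_cart)
      then show ?case using Z_l1[OF elim that] by linarith
    qed
    \<comment> \<open>Secures integrability; its dimension factor does not reach the rate, which
      comes from \<open>ZX_bound\<close>.\<close>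
    have norm_X: "AE \<omega> in P. norm (X t \<omega>) \<le> real CARD('n) * b" if "t \<in> {1..T}" for t
      using X_bounds
    proof eventually_elim
      case (elim \<omega>)
      have "norm (X t \<omega>) \<le> (\<Sum>i\<in>UNIV. \<bar>X t \<omega> $ i\<bar>)" by (rule norm_le_l1_cart)
      also have "\<dots> \<le> (\<Sum>i\<in>(UNIV :: 'n set). b)" using elim that by (intro sum_mono) auto
      finally show ?case by simp
    qed
    have ZX_bound: "AE \<omega> in P. \<bar>Z t \<omega> \<bullet> X t \<omega>\<bar> \<le> 2 * b" if "t \<in> {1..T}" for t
      using X_bounds AE_space
    proof eventually_elim
      case (elim \<omega>)
      have "\<bar>Z t \<omega> \<bullet> X t \<omega>\<bar> \<le> l1_norm (Z t \<omega>) * b"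
        using elim that by (intro inner_le_l1_norm) auto
      also have "\<dots> \<le> 2 * b"
        using Z_l1[OF elim(2) that] \<open>0 < b\<close> by (intro mult_right_mono) auto
      finally show ?case .
    qed
    have "measure P {\<omega> \<in> space P. 2 * b * sqrt (2 * real T * ln (1 / \<delta>))
        < (\<Sum>t=1..T. Z t \<omega> \<bullet> (vec_cond_exp P (F t) (X t) \<omega> - X t \<omega>))} \<le> \<delta>"
      by (rule azuma_hoeffding_inner[OF P sub filt X adapted Z_F norm_X Z_bound ZX_bound])
        (use \<open>0 < b\<close> T \<delta> in auto)
    moreover have "(\<lambda>\<omega>. \<Sum>t=1..T. Z t \<omega> \<bullet> N t \<omega>) \<in> borel_measurable P"
      unfolding N_def using X measurable_from_subalg[OF sub Z_F] measurable_from_subalg[OF sub G_F]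
      by (intro borel_measurable_sum borel_measurable_inner borel_measurable_diff) auto
    ultimately have "with_prob_at_least P (1 - \<delta>) (\<lambda>\<omega>. \<omega> \<in> space P \<and>
        (\<Sum>t=1..T. Z t \<omega> \<bullet> N t \<omega>) \<le> 2 * b * sqrt (2 * real T * ln (1 / \<delta>)))"
      by (intro with_prob_at_least_not_greater[OF P]) (auto simp: N_def G_def)
    then show ?thesis
    proof (rule with_prob_at_least_AE_mono[OF P])
      show "AE \<omega> in P. \<omega> \<in> space P \<and>
          (\<Sum>t=1..T. Z t \<omega> \<bullet> N t \<omega>) \<le> 2 * b * sqrt (2 * real T * ln (1 / \<delta>)) \<longrightarrow>
        (\<forall>A\<in>left_stochastic. (\<Sum>t=1..T. G t \<omega> \<bullet> (A *v l t \<omega> - l t \<omega>))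
          \<le> b * sqrt (real T) * ((3 / 2 + 2 * sqrt 2) * sqrt K + sqrt (8 * ln (1 / \<delta>))))"
        using X_bounds G_bounds
      proof eventually_elim
        case (elim \<omega>)
        show ?case
        proof (intro impI ballI, elim conjE)
          fix A :: "real ^ 'n ^ 'n" assume A: "A \<in> left_stochastic" and \<omega>: "\<omega> \<in> space P"
            and mart: "(\<Sum>t=1..T. Z t \<omega> \<bullet> N t \<omega>) \<le> 2 * b * sqrt (2 * real T * ln (1 / \<delta>))"
          have K_div: "K / sqrt K = sqrt K" and T_div: "real T / sqrt (real T) = sqrt (real T)"
            using \<open>0 < K\<close> by (simp_all add: real_div_sqrt)
          have regret: "(\<Sum>t=1..T. X t \<omega> \<bullet> (A *v l t \<omega> - l t \<omega>)) \<le> 3 / 2 * sqrt K * (b * sqrt (real T))"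
          proof -
            define \<beta> where "\<beta> = sqrt (K / (real T * b\<^sup>2))"
            have \<beta>: "\<beta> = sqrt K / (b * sqrt (real T))"
              using \<open>0 < b\<close> by (simp add: \<beta>_def real_sqrt_divide real_sqrt_mult)
            have "0 < \<beta>" using \<open>0 < b\<close> \<open>0 < K\<close> T by (simp add: \<beta>)
            \<comment> \<open>The one place where stationarity enters: \<open>l t\<close> is
              rewritten as the move of the matrix learner.\<close>
            have "(\<Sum>t=1..T. X t \<omega> \<bullet> (A *v l t \<omega> - l t \<omega>))
                = (\<Sum>t=1..T. X t \<omega> \<bullet> (A *v l t \<omega> - M t \<omega> *v l t \<omega>))"
              by (intro sum.cong refl) (simp add: stationary[OF \<omega>])
            also have "\<dots> \<le> K / \<beta> + \<beta> * real T * b\<^sup>2 / 2"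
              unfolding K_def using elim init[OF \<omega>] step[OF \<omega>] l_simplex[OF \<omega>] A \<open>0 < \<beta>\<close> \<open>0 < b\<close>
              by (intro exp_update_regret) (auto simp: \<beta>_def)
            also have "\<dots> = 3 / 2 * sqrt K * (b * sqrt (real T))"
            proof -
              have "K / \<beta> = K / sqrt K * (b * sqrt (real T))"
                by (simp add: \<beta>)
              moreover have "\<beta> * real T * b\<^sup>2 = sqrt K * (b * (real T / sqrt (real T)))"
                using \<open>0 < b\<close> by (simp add: \<beta> power2_eq_square)
              ultimately show ?thesis unfolding K_div T_div by linarith
            qed
            finally show ?thesis .
          qed
          have aux: "(\<Sum>t=1..T. N t \<omega> \<bullet> (A *v l t \<omega> - R t \<omega> *v l t \<omega>))
              \<le> 2 * sqrt 2 * sqrt K * (b * sqrt (real T))"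
          proof -
            have "0 < \<eta>" using \<open>0 < b\<close> \<open>0 < K\<close> T by (simp add: \<eta>_def)
            have N_bound: "\<bar>N t \<omega> $ i\<bar> \<le> 2 * b" if "t \<in> {1..T}" for t i
            proof -
              have "\<bar>G t \<omega> $ i\<bar> \<le> b" "\<bar>X t \<omega> $ i\<bar> \<le> b" using elim that by auto
              then show ?thesis by (simp add: N_def)
            qed
            have "(\<Sum>t=1..T. N t \<omega> \<bullet> (A *v l t \<omega> - R t \<omega> *v l t \<omega>))
                \<le> K / \<eta> + \<eta> * real T * (2 * b)\<^sup>2 / 2"
              unfolding K_def using N_bound R_init R_step l_simplex[OF \<omega>] A \<open>0 < \<eta>\<close> \<open>0 < b\<close>
              by (intro exp_update_regret) (auto simp: U_def)
            also have "\<dots> = 2 * sqrt 2 * sqrt K * (b * sqrt (real T))"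
            proof -
              have "K / \<eta> = K / sqrt K * (sqrt 2 * (b * sqrt (real T)))"
                by (simp add: \<eta>_def real_sqrt_mult)
              moreover have "\<eta> * real T * (2 * b)\<^sup>2 / 2
                  = 2 / sqrt 2 * sqrt K * (b * (real T / sqrt (real T)))"
                using \<open>0 < b\<close> by (simp add: \<eta>_def power2_eq_square real_sqrt_mult mult_ac)
              ultimately show ?thesis unfolding K_div T_div by (simp add: real_div_sqrt)
            qed
            finally show ?thesis .
          qed
          have split: "(\<Sum>t=1..T. G t \<omega> \<bullet> (A *v l t \<omega> - l t \<omega>)) = (\<Sum>t=1..T. X t \<omega> \<bullet> (A *v l t \<omega> - l t \<omega>))
              + (\<Sum>t=1..T. N t \<omega> \<bullet> (A *v l t \<omega> - R t \<omega> *v l t \<omega>)) + (\<Sum>t=1..T. Z t \<omega> \<bullet> N t \<omega>)"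
            unfolding sum.distrib[symmetric]
            by (intro sum.cong refl)
              (simp add: N_def Z_def inner_diff_left inner_diff_right inner_commute algebra_simps)
          have "2 * b * sqrt (2 * real T * ln (1 / \<delta>)) = b * sqrt (real T) * sqrt (8 * ln (1 / \<delta>))"
            by (simp add: real_sqrt_mult sqrt_8)
          moreover have "b * sqrt (real T) * ((3 / 2 + 2 * sqrt 2) * sqrt K + sqrt (8 * ln (1 / \<delta>)))
              = 3 / 2 * sqrt K * (b * sqrt (real T)) + 2 * sqrt 2 * sqrt K * (b * sqrt (real T))
                + b * sqrt (real T) * sqrt (8 * ln (1 / \<delta>))"
            by (simp add: algebra_simps)
          ultimately show "(\<Sum>t=1..T. G t \<omega> \<bullet> (A *v l t \<omega> - l t \<omega>))
              \<le> b * sqrt (real T) * ((3 / 2 + 2 * sqrt 2) * sqrt K + sqrt (8 * ln (1 / \<delta>)))"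
            unfolding split using regret aux mart by linarith
        qed
      qed
    qed
  qed
qed

section \<open>Linearity in the multipliers and the numerical constants\<close>

lemma L_lambda_eq_inner:
  assumes "GDERIV (L_lambda g \<theta>) l :> c"
  shows "L_lambda g \<theta> l' = c \<bullet> l'"
proof -
  \<comment> \<open>A linear map is its own derivative, so the gradient represents
    \<open>L_lambda g \<theta>\<close> exactly. Value differences thus equal pairings with the
    gradient, whatever the shape of the constraints \<open>g\<close>.\<close>
  have "linear (L_lambda g \<theta>)"
    by (rule linearI) (simp_all add: L_lambda_def sum.distrib algebra_simps sum_distrib_left)
  then have "(L_lambda g \<theta> has_derivative L_lambda g \<theta>) (at l)"
    by (intro bounded_linear_imp_has_derivative) (simp add: linear_conv_bounded_linear)
  from has_derivative_unique[OF this assms[unfolded gderiv_def]]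
  show ?thesis by (metis inner_commute)
qed

text \<open>At \<open>L = 0\<close> the inequality fails, so it matters that
  \<open>L = ln (2 / \<delta>)\<close> is at least \<open>ln 2\<close>, hence at least
  \<open>2 / 3\<close>. Estimating \<open>sqrt 2\<close> by \<open>3 / 2\<close> and the right side
  from below by \<open>8 * sqrt L\<close>, what remains is \<open>sqrt L \<ge> 5 / 8\<close>, and
  \<open>4 / 5\<close> is available.\<close>

lemma rate_constant_theta:
  fixes L :: real
  assumes "2 / 3 \<le> L"
  shows "3 / 4 * sqrt 2 + 2 + sqrt (8 * L) \<le> 2 * sqrt (1 + 16 * L)"
proof -
  have "sqrt ((4 / 5)\<^sup>2) \<le> sqrt L"
    by (rule real_sqrt_le_mono) (use assms in \<open>simp add: power2_eq_square\<close>)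
  then have q: "4 / 5 \<le> sqrt L" by simp
  have "sqrt 2 \<le> sqrt ((3 / 2)\<^sup>2)"
    by (rule real_sqrt_le_mono) (simp add: power2_eq_square)
  then have s2: "sqrt 2 \<le> 3 / 2" by simp
  have "sqrt (8 * L) = 2 * sqrt 2 * sqrt L"
    by (simp add: real_sqrt_mult sqrt_8)
  also have "\<dots> \<le> 3 * sqrt L"
    using s2 q assms by (intro mult_right_mono) auto
  finally have s8: "sqrt (8 * L) \<le> 3 * sqrt L" .
  have "4 * sqrt L = sqrt (16 * L)" by (simp add: real_sqrt_mult)
  also have "\<dots> \<le> sqrt (1 + 16 * L)" by simp
  finally show ?thesis using q s2 s8 by linarith
qed

text \<open>The deviation term has no factor \<open>sqrt K\<close>; as
  \<open>1 \<le> sqrt K\<close>, it can be given one. After division by \<open>sqrt K\<close> the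
  bound \<open>4 / 5 \<le> sqrt L\<close> suffices again.\<close>

lemma rate_constant_lambda:
  fixes K L :: real
  assumes "2 / 3 \<le> L" "1 \<le> K"
  shows "(3 / 2 + 2 * sqrt 2) * sqrt K + sqrt (8 * L) \<le> 2 * sqrt (2 * K * (1 + 16 * L))"
proof -
  have "sqrt ((4 / 5)\<^sup>2) \<le> sqrt L"
    by (rule real_sqrt_le_mono) (use assms in \<open>simp add: power2_eq_square\<close>)
  then have q: "4 / 5 \<le> sqrt L" by simp
  have s2: "1 \<le> sqrt 2" by simp
  have k: "1 \<le> sqrt K" using assms by simp
  have "sqrt (8 * L) = 2 * sqrt 2 * sqrt L * 1"
    by (simp add: real_sqrt_mult sqrt_8)
  also have "\<dots> \<le> 2 * sqrt 2 * sqrt L * sqrt K"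
    using k assms by (intro mult_left_mono) (auto intro!: mult_nonneg_nonneg)
  finally have "(3 / 2 + 2 * sqrt 2) * sqrt K + sqrt (8 * L)
      \<le> (3 / 2 + 2 * sqrt 2 + 2 * sqrt 2 * sqrt L) * sqrt K"
    by (simp add: algebra_simps)
  also have "\<dots> \<le> (2 * sqrt 2 * (4 * sqrt L)) * sqrt K"
  proof (rule mult_right_mono)
    have "sqrt 2 * (4 / 5) \<le> sqrt 2 * sqrt L"
      using q by (intro mult_left_mono) auto
    then show "3 / 2 + 2 * sqrt 2 + 2 * sqrt 2 * sqrt L \<le> 2 * sqrt 2 * (4 * sqrt L)"
      using s2 by linarith
  qed (use assms in simp)
  also have "\<dots> \<le> (2 * sqrt 2 * sqrt (1 + 16 * L)) * sqrt K"
  proof (intro mult_right_mono mult_left_mono)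
    have "4 * sqrt L = sqrt (16 * L)" by (simp add: real_sqrt_mult)
    also have "\<dots> \<le> sqrt (1 + 16 * L)" by simp
    finally show "4 * sqrt L \<le> sqrt (1 + 16 * L)" .
  qed (use assms in auto)
  also have "\<dots> = 2 * sqrt (2 * K * (1 + 16 * L))"
    by (simp add: real_sqrt_mult)
  finally show ?thesis .
qed

section \<open>Union bound over the two players and passage from regret to Lagrangian values\<close>

theorem lemma4:
  fixes \<Theta> :: "(real ^ 'd) set"
    and g0 :: "real ^ 'd \<Rightarrow> real"
    and g gt :: "'m::finite \<Rightarrow> real ^ 'd \<Rightarrow> real"
    and P :: "'w measure"
    and \<theta> D_sub :: "nat \<Rightarrow> 'w \<Rightarrow> real ^ 'd"
    and l D_grad :: "nat \<Rightarrow> 'w \<Rightarrow> real ^ ('m option)"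
    and M :: "nat \<Rightarrow> 'w \<Rightarrow> real ^ ('m option) ^ ('m option)"
    and T :: nat
    and B_Theta B_sub B_grad eta_theta eta_lambda \<delta> :: real
  assumes Theta: "compact \<Theta>" "convex \<Theta>" "0 \<in> \<Theta>"
    and convex_objective: "convex_on \<Theta> g0"
    and convex_proxies: "\<And>i. convex_on \<Theta> (gt i)"
    and proxies_ge: "\<And>i x. x \<in> \<Theta> \<Longrightarrow> gt i x \<ge> g i x"
    and T: "T \<ge> 1"
    and delta: "0 < \<delta>" "\<delta> < 1"
    and prob: "prob_space P"
    and meas_lambda: "\<And>t. t \<in> {1..T} \<Longrightarrow> l t \<in> borel_measurable P"
    and meas_D_theta: "\<And>t. t \<in> {1..T} \<Longrightarrow> D_sub t \<in> borel_measurable P"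
    and meas_D_lambda: "\<And>t. t \<in> {1..T} \<Longrightarrow> D_grad t \<in> borel_measurable P"
    and bound_Theta: "\<And>x. x \<in> \<Theta> \<Longrightarrow> norm x \<le> B_Theta"
    and bound_D_theta: "AE \<omega> in P. \<forall>t\<in>{1..T}. norm (D_sub t \<omega>) \<le> B_sub"
    and bound_D_lambda: "AE \<omega> in P. \<forall>t\<in>{1..T}. infnorm (D_grad t \<omega>) \<le> B_grad"
    and step_theta: "eta_theta = B_Theta / (B_sub * sqrt (2 * real T))"
    and step_lambda: "eta_lambda = sqrt (real (CARD('m) + 1) * ln (real (CARD('m) + 1)) / (real T * B_grad\<^sup>2))"
    and run: "\<And>\<omega>. \<omega> \<in> space P \<Longrightarrow>
      proxy_lagrangian_run \<Theta> eta_theta eta_lambda T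
        (\<lambda>t. \<theta> t \<omega>) (\<lambda>t. l t \<omega>) (\<lambda>t. M t \<omega>) (\<lambda>t. D_sub t \<omega>) (\<lambda>t. D_grad t \<omega>)"
    and stochastic_subgradient: "\<And>t. t \<in> {1..T} \<Longrightarrow> AE \<omega> in P.
      vec_cond_exp P (history P \<theta> l D_sub D_grad t) (D_sub t) \<omega>
        \<in> subdifferential \<Theta> (\<lambda>x. L_theta g0 gt x (l t \<omega>)) (\<theta> t \<omega>)"
    and stochastic_gradient: "\<And>t. t \<in> {1..T} \<Longrightarrow> AE \<omega> in P.
      GDERIV (L_lambda g (\<theta> t \<omega>)) (l t \<omega>)
        :> vec_cond_exp P (history P \<theta> l D_sub D_grad t) (D_grad t) \<omega>"
  shows "with_prob_at_least P (1 - \<delta>) (\<lambda>\<omega>.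
      1 / real T * (\<Sum>t=1..T. L_theta g0 gt (\<theta> t \<omega>) (l t \<omega>))
        - (INF x\<in>\<Theta>. 1 / real T * (\<Sum>t=1..T. L_theta g0 gt x (l t \<omega>)))
      \<le> 2 * B_Theta * B_sub * sqrt ((1 + 16 * ln (2 / \<delta>)) / real T) \<and>
      (SUP A\<in>left_stochastic. 1 / real T * (\<Sum>t=1..T. L_lambda g (\<theta> t \<omega>) (A *v l t \<omega>)))
        - 1 / real T * (\<Sum>t=1..T. L_lambda g (\<theta> t \<omega>) (l t \<omega>))
      \<le> 2 * B_grad * sqrt (2 * real (CARD('m) + 1) * ln (real (CARD('m) + 1))
            * (1 + 16 * ln (2 / \<delta>)) / real T))"
proof -
  interpret prob_space P by fact
  define F where "F = history P \<theta> l D_sub D_grad"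
  define n where "n = real (CARD('m) + 1)"
  define K where "K = n * ln n"
  define L where "L = ln (2 / \<delta>)"
  \<comment> \<open>Types are nonempty, so there is at least one constraint, hence two coordinates
    and \<open>ln n > 0\<close>.\<close>
  have n: "n = real CARD('m option)" "2 \<le> CARD('m option)" "2 \<le> n"
    by (auto simp: n_def Suc_le_eq)
  have \<theta>_init: "\<theta> 1 \<omega> = 0" and M_init: "M 1 \<omega> = (\<chi> i j. 1 / real CARD('m option))"
    if "\<omega> \<in> space P" for \<omega>
    using run[OF that] by (auto simp: proxy_lagrangian_run_def)
  have l_simplex: "l t \<omega> \<in> simplex_set" and stationary: "M t \<omega> *v l t \<omega> = l t \<omega>"
    and \<theta>_step: "\<theta> (t + 1) \<omega> = closest_point \<Theta> (\<theta> t \<omega> - eta_theta *\<^sub>R D_sub t \<omega>)"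
    and M_step: "M (t + 1) \<omega> = update_step eta_lambda (M t \<omega>) (D_grad t \<omega>) (l t \<omega>)"
    if "\<omega> \<in> space P" "t \<in> {1..T}" for \<omega> t
    using run[OF that(1)] that(2) by (auto simp: proxy_lagrangian_run_def update_step_def)
  have closed: "closed \<Theta>" using Theta by (simp add: compact_imp_closed)
  have \<theta>_in: "\<theta> t \<omega> \<in> \<Theta>" if \<omega>: "\<omega> \<in> space P" and t: "t \<in> {1..T}" for t \<omega>
  proof (cases "t = 1")
    case False
    then have "t - 1 \<in> {1..T}" using t by auto
    from \<theta>_step[OF \<omega> this] show ?thesis
      using False t closed Theta closest_point_in_set[of \<Theta>] by auto
  qed (use \<theta>_init[OF \<omega>] Theta in auto)
  \<comment> \<open>Follows from the recursion, because projection onto a closed convex set is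
    continuous; it makes the history a subalgebra of \<open>P\<close>. The recursion is known on
    \<open>space P\<close> only, hence \<open>measurable_cong\<close>.\<close>
  have \<theta>_meas: "\<theta> t \<in> borel_measurable P" if "t \<in> {1..T}" for t
    using that
  proof (induction t)
    case (Suc t)
    show ?case
    proof (cases "t = 0")
      case True
      then have "\<theta> (Suc t) \<in> borel_measurable P \<longleftrightarrow> (\<lambda>_. 0 :: real ^ 'd) \<in> borel_measurable P"
        using \<theta>_init by (intro measurable_cong) auto
      then show ?thesis by simp
    next
      case False
      then have t: "t \<in> {1..T}" using Suc.prems by auto
      have "(\<lambda>\<omega>. \<theta> t \<omega> - eta_theta *\<^sub>R D_sub t \<omega>) \<in> borel_measurable P"
        using Suc.IH[OF t] meas_D_theta[OF t] by measurable
      then have "(\<lambda>\<omega>. closest_point \<Theta> (\<theta> t \<omega> - eta_theta *\<^sub>R D_sub t \<omega>)) \<in> borel_measurable P"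
        using closed Theta
        by (intro borel_measurable_continuous_on[OF continuous_on_closest_point]) auto
      also have "?this \<longleftrightarrow> \<theta> (Suc t) \<in> borel_measurable P"
        using \<theta>_step[OF _ t] by (intro measurable_cong) auto
      finally show ?thesis .
    qed
  qed auto
  have sub: "subalgebra P (F t)" if "t \<in> {1..T}" for t
    unfolding F_def using that
    by (intro subalgebra_history \<theta>_meas meas_lambda meas_D_theta meas_D_lambda) auto
  have filt: "subalgebra (F t) (F s)" if "1 \<le> s" "s < t" "t \<le> T" for s t
    unfolding F_def using that by (intro subalgebra_history_mono) auto
  have adapted: "D_sub s \<in> borel_measurable (F t)" "D_grad s \<in> borel_measurable (F t)"
    if "1 \<le> s" "s < t" "t \<le> T" for s t
    unfolding F_def using that by (auto intro: measurable_history)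
  have iter_F: "\<theta> t \<in> borel_measurable (F t)" "l t \<in> borel_measurable (F t)" if "t \<in> {1..T}" for t
    unfolding F_def using that by (auto intro: measurable_history)
  define G where "G t = vec_cond_exp P (F t) (D_sub t)" for t
  define H where "H t = vec_cond_exp P (F t) (D_grad t)" for t
  \<comment> \<open>Each player gets half of the failure probability, which is the source of
    \<open>ln (2 / \<delta>)\<close>.\<close>
  have half: "0 < \<delta> / 2" "\<delta> / 2 < 1" "1 / (\<delta> / 2) = 2 / \<delta>" using delta by auto
  have D_sub_bound: "AE \<omega> in P. norm (D_sub t \<omega>) \<le> B_sub"
    and D_grad_bound: "AE \<omega> in P. infnorm (D_grad t \<omega>) \<le> B_grad" if "t \<in> {1..T}" for t
    using bound_D_theta bound_D_lambda that by (auto elim: eventually_mono)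
  have "with_prob_at_least P (1 - \<delta> / 2) (\<lambda>\<omega>. \<forall>x\<in>\<Theta>. (\<Sum>t=1..T. G t \<omega> \<bullet> (\<theta> t \<omega> - x))
      \<le> B_Theta * B_sub * sqrt (real T) * (3 / 4 * sqrt 2 + 2 + sqrt (8 * L)))"
    unfolding G_def L_def half(3)[symmetric]
    by (rule stochastic_subgradient_regret[OF prob sub filt meas_D_theta adapted(1) iter_F(1)
          D_sub_bound closed Theta(2,3) bound_Theta \<theta>_init \<theta>_step[unfolded step_theta] T half(1,2)])
  moreover
  have step': "M (t + 1) \<omega> = update_step (sqrt (real CARD('m option) * ln (real CARD('m option))
      / (real T * B_grad\<^sup>2))) (M t \<omega>) (D_grad t \<omega>) (l t \<omega>)"
    if "\<omega> \<in> space P" "t \<in> {1..T}" for \<omega> t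
    using M_step[OF that] by (simp add: step_lambda n(1)[symmetric] n_def)
  note multiplier = stochastic_multiplier_regret[where M = M, OF prob sub filt meas_D_lambda adapted(2)
      iter_F(2) D_grad_bound M_init step' l_simplex stationary n(2) T half(1,2)]
  have "with_prob_at_least P (1 - \<delta> / 2) (\<lambda>\<omega>. \<forall>A\<in>left_stochastic.
      (\<Sum>t=1..T. H t \<omega> \<bullet> (A *v l t \<omega> - l t \<omega>))
      \<le> B_grad * sqrt (real T) * ((3 / 2 + 2 * sqrt 2) * sqrt K + sqrt (8 * L)))"
    unfolding H_def L_def half(3)[symmetric] K_def n(1) by (rule multiplier(1))
  ultimately have "with_prob_at_least P (1 - (\<delta> / 2 + \<delta> / 2)) (\<lambda>\<omega>.
      (\<forall>x\<in>\<Theta>. (\<Sum>t=1..T. G t \<omega> \<bullet> (\<theta> t \<omega> - x))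
        \<le> B_Theta * B_sub * sqrt (real T) * (3 / 4 * sqrt 2 + 2 + sqrt (8 * L))) \<and>
      (\<forall>A\<in>left_stochastic. (\<Sum>t=1..T. H t \<omega> \<bullet> (A *v l t \<omega> - l t \<omega>))
        \<le> B_grad * sqrt (real T) * ((3 / 2 + 2 * sqrt 2) * sqrt K + sqrt (8 * L))))"
    by (rule with_prob_at_least_conj[OF prob])
  then have both: "with_prob_at_least P (1 - \<delta>) (\<lambda>\<omega>.
      (\<forall>x\<in>\<Theta>. (\<Sum>t=1..T. G t \<omega> \<bullet> (\<theta> t \<omega> - x))
        \<le> B_Theta * B_sub * sqrt (real T) * (3 / 4 * sqrt 2 + 2 + sqrt (8 * L))) \<and>
      (\<forall>A\<in>left_stochastic. (\<Sum>t=1..T. H t \<omega> \<bullet> (A *v l t \<omega> - l t \<omega>))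
        \<le> B_grad * sqrt (real T) * ((3 / 2 + 2 * sqrt 2) * sqrt K + sqrt (8 * L))))"
    by simp
  have "AE \<omega> in P. 0 \<le> B_sub"
  proof -
    have "AE \<omega> in P. norm (D_sub 1 \<omega>) \<le> B_sub" using D_sub_bound T by simp
    then show ?thesis by eventually_elim (rule order_trans[OF norm_ge_zero])
  qed
  then have "0 \<le> B_sub" by simp
  have "0 \<le> B_grad" by (rule multiplier(2))
  have "0 \<le> B_Theta" using bound_Theta[OF Theta(3)] by simp
  have "ln 2 \<le> L" using delta by (simp add: L_def field_simps)
  then have "2 / 3 \<le> L" using ln2_ge_two_thirds by linarith
  have "4 / 3 \<le> K"
  proof -
    have "2 * (2 / 3) \<le> n * ln n"
    proof (rule mult_mono)
      have "ln 2 \<le> ln n" using n(3) by simp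
      then show "2 / 3 \<le> ln n" using ln2_ge_two_thirds by linarith
    qed (use n(3) in auto)
    then show ?thesis by (simp add: K_def)
  qed
  have rescale: "1 / real T * (c * sqrt (real T) * d) = c / sqrt (real T) * d" for c d
  proof -
    have "1 / real T * (c * sqrt (real T) * d) = c * (sqrt (real T) / real T) * d" by simp
    also have "sqrt (real T) / real T = inverse (sqrt (real T))"
      by (simp add: sqrt_divide_self_eq)
    finally show ?thesis by (simp add: divide_inverse)
  qed
  have rate_theta: "1 / real T * (B_Theta * B_sub * sqrt (real T) * (3 / 4 * sqrt 2 + 2 + sqrt (8 * L)))
      \<le> 2 * B_Theta * B_sub * sqrt ((1 + 16 * L) / real T)"
  proof -
    have "1 / real T * (B_Theta * B_sub * sqrt (real T) * (3 / 4 * sqrt 2 + 2 + sqrt (8 * L)))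
        = B_Theta * B_sub / sqrt (real T) * (3 / 4 * sqrt 2 + 2 + sqrt (8 * L))"
      by (rule rescale)
    also have "\<dots> \<le> B_Theta * B_sub / sqrt (real T) * (2 * sqrt (1 + 16 * L))"
      using rate_constant_theta[OF \<open>2 / 3 \<le> L\<close>] \<open>0 \<le> B_Theta\<close> \<open>0 \<le> B_sub\<close>
      by (intro mult_left_mono) auto
    finally show ?thesis by (simp add: real_sqrt_divide mult_ac)
  qed
  have rate_lambda: "1 / real T * (B_grad * sqrt (real T) * ((3 / 2 + 2 * sqrt 2) * sqrt K + sqrt (8 * L)))
      \<le> 2 * B_grad * sqrt (2 * n * ln n * (1 + 16 * L) / real T)"
  proof -
    have "1 / real T * (B_grad * sqrt (real T) * ((3 / 2 + 2 * sqrt 2) * sqrt K + sqrt (8 * L)))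
        = B_grad / sqrt (real T) * ((3 / 2 + 2 * sqrt 2) * sqrt K + sqrt (8 * L))"
      by (rule rescale)
    also have "\<dots> \<le> B_grad / sqrt (real T) * (2 * sqrt (2 * K * (1 + 16 * L)))"
      using rate_constant_lambda[OF \<open>2 / 3 \<le> L\<close>, of K] \<open>4 / 3 \<le> K\<close> \<open>0 \<le> B_grad\<close>
      by (intro mult_left_mono) auto
    finally show ?thesis by (simp add: K_def real_sqrt_divide mult_ac)
  qed
  have sub_AE: "AE \<omega> in P. \<forall>t\<in>{1..T}.
      G t \<omega> \<in> subdifferential \<Theta> (\<lambda>x. L_theta g0 gt x (l t \<omega>)) (\<theta> t \<omega>)"
    unfolding G_def F_def using stochastic_subgradient by (intro AE_finite_allI) auto
  have grad_AE: "AE \<omega> in P. \<forall>t\<in>{1..T}. GDERIV (L_lambda g (\<theta> t \<omega>)) (l t \<omega>) :> H t \<omega>"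
    unfolding H_def F_def using stochastic_gradient by (intro AE_finite_allI) auto
  show ?thesis
    unfolding n_def[symmetric] L_def[symmetric]
  proof (rule with_prob_at_least_AE_mono[OF prob both])
    show "AE \<omega> in P. (\<forall>x\<in>\<Theta>. (\<Sum>t=1..T. G t \<omega> \<bullet> (\<theta> t \<omega> - x))
        \<le> B_Theta * B_sub * sqrt (real T) * (3 / 4 * sqrt 2 + 2 + sqrt (8 * L))) \<and>
      (\<forall>A\<in>left_stochastic. (\<Sum>t=1..T. H t \<omega> \<bullet> (A *v l t \<omega> - l t \<omega>))
        \<le> B_grad * sqrt (real T) * ((3 / 2 + 2 * sqrt 2) * sqrt K + sqrt (8 * L))) \<longrightarrow>
      1 / real T * (\<Sum>t=1..T. L_theta g0 gt (\<theta> t \<omega>) (l t \<omega>))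
        - (INF x\<in>\<Theta>. 1 / real T * (\<Sum>t=1..T. L_theta g0 gt x (l t \<omega>)))
      \<le> 2 * B_Theta * B_sub * sqrt ((1 + 16 * L) / real T) \<and>
      (SUP A\<in>left_stochastic. 1 / real T * (\<Sum>t=1..T. L_lambda g (\<theta> t \<omega>) (A *v l t \<omega>)))
        - 1 / real T * (\<Sum>t=1..T. L_lambda g (\<theta> t \<omega>) (l t \<omega>))
      \<le> 2 * B_grad * sqrt (2 * n * ln n * (1 + 16 * L) / real T)"
      using sub_AE grad_AE
    proof (eventually_elim, intro impI conjI; elim conjE)
      fix \<omega>
      assume subgrad: "\<forall>t\<in>{1..T}. G t \<omega> \<in> subdifferential \<Theta> (\<lambda>x. L_theta g0 gt x (l t \<omega>)) (\<theta> t \<omega>)"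
        and regret: "\<forall>x\<in>\<Theta>. (\<Sum>t=1..T. G t \<omega> \<bullet> (\<theta> t \<omega> - x))
          \<le> B_Theta * B_sub * sqrt (real T) * (3 / 4 * sqrt 2 + 2 + sqrt (8 * L))"
      have "1 / real T * (\<Sum>t=1..T. L_theta g0 gt (\<theta> t \<omega>) (l t \<omega>))
          - 2 * B_Theta * B_sub * sqrt ((1 + 16 * L) / real T)
        \<le> (INF x\<in>\<Theta>. 1 / real T * (\<Sum>t=1..T. L_theta g0 gt x (l t \<omega>)))"
      \<comment> \<open>A bound that holds at each comparator passes to the infimum over a nonempty
        set, without choosing a minimiser; the supremum over matrices below is treated in the same
        way.\<close>
      proof (rule cINF_greatest)
        fix x assume x: "x \<in> \<Theta>"
        have "(\<Sum>t=1..T. L_theta g0 gt (\<theta> t \<omega>) (l t \<omega>)) - (\<Sum>t=1..T. L_theta g0 gt x (l t \<omega>))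
            \<le> (\<Sum>t=1..T. G t \<omega> \<bullet> (\<theta> t \<omega> - x))"
          unfolding sum_subtractf[symmetric]
        proof (rule sum_mono)
          fix t assume "t \<in> {1..T}"
          then have "L_theta g0 gt (\<theta> t \<omega>) (l t \<omega>) + G t \<omega> \<bullet> (x - \<theta> t \<omega>) \<le> L_theta g0 gt x (l t \<omega>)"
            using subgrad x by (auto simp: subdifferential_def)
          then show "L_theta g0 gt (\<theta> t \<omega>) (l t \<omega>) - L_theta g0 gt x (l t \<omega>) \<le> G t \<omega> \<bullet> (\<theta> t \<omega> - x)"
            by (simp add: inner_diff_right)
        qed
        also have "\<dots> \<le> B_Theta * B_sub * sqrt (real T) * (3 / 4 * sqrt 2 + 2 + sqrt (8 * L))"
          using regret x by blast
        finally have "1 / real T * ((\<Sum>t=1..T. L_theta g0 gt (\<theta> t \<omega>) (l t \<omega>)) - (\<Sum>t=1..T. L_theta g0 gt x (l t \<omega>)))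
            \<le> 1 / real T * (B_Theta * B_sub * sqrt (real T) * (3 / 4 * sqrt 2 + 2 + sqrt (8 * L)))"
          by (rule mult_left_mono) simp
        then show "1 / real T * (\<Sum>t=1..T. L_theta g0 gt (\<theta> t \<omega>) (l t \<omega>))
            - 2 * B_Theta * B_sub * sqrt ((1 + 16 * L) / real T)
          \<le> 1 / real T * (\<Sum>t=1..T. L_theta g0 gt x (l t \<omega>))"
          using rate_theta unfolding right_diff_distrib by linarith
      qed (use Theta in auto)
      then show "1 / real T * (\<Sum>t=1..T. L_theta g0 gt (\<theta> t \<omega>) (l t \<omega>))
        - (INF x\<in>\<Theta>. 1 / real T * (\<Sum>t=1..T. L_theta g0 gt x (l t \<omega>)))
        \<le> 2 * B_Theta * B_sub * sqrt ((1 + 16 * L) / real T)"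
        by linarith
    next
      fix \<omega>
      assume grad: "\<forall>t\<in>{1..T}. GDERIV (L_lambda g (\<theta> t \<omega>)) (l t \<omega>) :> H t \<omega>"
        and regret: "\<forall>A\<in>left_stochastic. (\<Sum>t=1..T. H t \<omega> \<bullet> (A *v l t \<omega> - l t \<omega>))
          \<le> B_grad * sqrt (real T) * ((3 / 2 + 2 * sqrt 2) * sqrt K + sqrt (8 * L))"
      have "(SUP A\<in>left_stochastic. 1 / real T * (\<Sum>t=1..T. L_lambda g (\<theta> t \<omega>) (A *v l t \<omega>)))
        \<le> 1 / real T * (\<Sum>t=1..T. L_lambda g (\<theta> t \<omega>) (l t \<omega>))
          + 2 * B_grad * sqrt (2 * n * ln n * (1 + 16 * L) / real T)"
      proof (rule cSUP_least)
        show "(left_stochastic :: (real ^ 'm option ^ 'm option) set) \<noteq> {}"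
          using positive_stochastic_left_stochastic[OF uniform_positive_stochastic] by blast
      next
        fix A :: "real ^ 'm option ^ 'm option" assume A: "A \<in> left_stochastic"
        have "(\<Sum>t=1..T. L_lambda g (\<theta> t \<omega>) (A *v l t \<omega>)) - (\<Sum>t=1..T. L_lambda g (\<theta> t \<omega>) (l t \<omega>))
            = (\<Sum>t=1..T. H t \<omega> \<bullet> (A *v l t \<omega> - l t \<omega>))"
          unfolding sum_subtractf[symmetric]
        proof (rule sum.cong[OF refl])
          fix t assume "t \<in> {1..T}"
          then have "GDERIV (L_lambda g (\<theta> t \<omega>)) (l t \<omega>) :> H t \<omega>" using grad by blast
          note lin = L_lambda_eq_inner[OF this]
          show "L_lambda g (\<theta> t \<omega>) (A *v l t \<omega>) - L_lambda g (\<theta> t \<omega>) (l t \<omega>)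
              = H t \<omega> \<bullet> (A *v l t \<omega> - l t \<omega>)"
            unfolding lin[of "A *v l t \<omega>"] lin[of "l t \<omega>"] by (simp add: inner_diff_right)
        qed
        also have "\<dots> \<le> B_grad * sqrt (real T) * ((3 / 2 + 2 * sqrt 2) * sqrt K + sqrt (8 * L))"
          using regret A by blast
        finally have "1 / real T * ((\<Sum>t=1..T. L_lambda g (\<theta> t \<omega>) (A *v l t \<omega>)) - (\<Sum>t=1..T. L_lambda g (\<theta> t \<omega>) (l t \<omega>)))
            \<le> 1 / real T * (B_grad * sqrt (real T) * ((3 / 2 + 2 * sqrt 2) * sqrt K + sqrt (8 * L)))"
          by (rule mult_left_mono) simp
        then show "1 / real T * (\<Sum>t=1..T. L_lambda g (\<theta> t \<omega>) (A *v l t \<omega>))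
          \<le> 1 / real T * (\<Sum>t=1..T. L_lambda g (\<theta> t \<omega>) (l t \<omega>))
            + 2 * B_grad * sqrt (2 * n * ln n * (1 + 16 * L) / real T)"
          using rate_lambda unfolding right_diff_distrib by linarith
      qed
      then show "(SUP A\<in>left_stochastic. 1 / real T * (\<Sum>t=1..T. L_lambda g (\<theta> t \<omega>) (A *v l t \<omega>)))
        - 1 / real T * (\<Sum>t=1..T. L_lambda g (\<theta> t \<omega>) (l t \<omega>))
        \<le> 2 * B_grad * sqrt (2 * n * ln n * (1 + 16 * L) / real T)"
        by linarith
    qed
  qed
qed

end
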